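(* Let $\mathcal C_1,\mathcal C_2:\mathbb R^d\to\mathbb R^d$ be a $\delta_1$-approximate and a $\delta_2$-approximate compressor with $\delta_1\in(0,1]$, $\delta_2\in[0,1]$, and let $H>0$ be the (integer) error-reset interval. Assume the smoothness, gradient and global minimum assumptions stated in the context, with constants $L$, $V_1$, $V_1'$, $V_2=V_1+V_1'$ and global minimum $x_*$. Take $$\eta=\min\left\{\frac{\gamma}{\sqrt{T/n}+\left[4(1-\delta_1)/\delta_1^2+1\right]^{1/3}2^{1/3}(1-\delta_2)^{1/3}H^{2/3}T^{1/3}},\ \frac1L\right\}$$ for some $\gamma>0$, let $(x_{i,t})$ be the iterates of CSER with step size $\eta$, $\bar x_t=\frac1n\sum_{i\in[n]}x_{i,t}$ and $F_o=2[F(\bar x_0)-F(x_* )]$. Then after $T\gg n$ iterations CSER converges to a critical point, in the sense that $$\frac1T\sum_{t=1}^T\mathbb E\big[\|\nabla F(\bar x_{t-1})\|^2\big]\le\frac1{\sqrt{nT}}\left[\frac{F_o}{\gamma}+\gamma LV_1\right]+\frac{\left[4(1-\delta_1)/\delta_1^2+1\right]^{1/3}2^{1/3}(1-\delta_2)^{1/3}H^{2/3}}{T^{2/3}}\left[\frac{F_o}{\gamma}+\gamma^2L^2V_2\right]\le\mathcal O\left(\frac1{\sqrt{nT}}\right).$$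
   Context: Notation: $[n]=\{1,\dots,n\}$, where $n$ is the number of workers; $\|\cdot\|$ is the Euclidean norm on $\mathbb R^d$. Problem: minimize $F(x)=\frac1n\sum_{i\in[n]}F_i(x)$ over $x\in\mathbb R^d$, where $F_i(x)=\mathbb E_{z_i\sim\mathcal D_i}f(x;z_i)$ and $z_i$ is sampled from the local data $\mathcal D_i$ of worker $i$; it is assumed that $\mathcal D_i\ne\mathcal D_j$ for $i\ne j$. $\nabla f(x;z)$ is the gradient in $x$. Compressor: $\mathcal C:\mathbb R^d\to\mathbb R^d$ is a $\delta$-approximate compressor, $\delta\in[0,1]$, if $\|\mathcal C(v)-v\|^2\le(1-\delta)\|v\|^2$ for all $v\in\mathbb R^d$. Partial synchronization: given vectors $v_1,\dots,v_n\in\mathbb R^d$ held by the $n$ workers, $\mathrm{PSync}(v_i,\mathcal C)$ returns to worker $i$ the pair $(v_i',r_i)$ with $r_i=v_i-\mathcal C(v_i)$ and $v_i'=\frac1n\sum_{k\in[n]}\mathcal C(v_k)+r_i$. CSER algorithm: initialize $x_{i,0}=\hat x_0\in\mathbb R^d$ (the same for all $i$), $e_{i,0}=0$. For $t=1,\dots,T$ and every worker $i\in[n]$: sample $z_{i,t}\sim\mathcal D_i$ and set $g_{i,t}=\nabla f(x_{i,t-1};z_{i,t})$; $(g'_{i,t},r_{i,t})=\mathrm{PSync}(g_{i,t},\mathcal C_2)$; $x_{i,t-\frac12}=x_{i,t-1}-\eta g'_{i,t}$; $e_{i,t-\frac12}=e_{i,t-1}-\eta r_{i,t}$. If $H\nmid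 t$: $x_{i,t}=x_{i,t-\frac12}$, $e_{i,t}=e_{i,t-\frac12}$. If $H\mid t$: $(e'_{i,t-\frac12},e_{i,t})=\mathrm{PSync}(e_{i,t-\frac12},\mathcal C_1)$ and $x_{i,t}=x_{i,t-\frac12}-e_{i,t-\frac12}+e'_{i,t-\frac12}$. Smoothness assumption: each $F_i$, $i\in[n]$, is $L$-smooth, meaning $F_i(y)-F_i(x)\le\langle\nabla F_i(x),y-x\rangle+\frac L2\|y-x\|^2$ for all $x,y$. Gradient assumption: for every stochastic gradient $g_{i,t}=\nabla f(x_{i,t-1};z_{i,t})$, $z_{i,t}\sim\mathcal D_i$, one has $\mathbb E[\|g_{i,t}-\nabla F_i(x_{i,t-1})\|^2]\le V_1$ and $\|\mathbb E[g_{i,t}]\|^2\le V_1'$ for all $i\in[n]$, $t\in[T]$; furthermore, gradients from different workers are independent of each other. (The bound $\mathbb E[\|g_{i,t}\|^2]\le V_2:=V_1+V_1'$ is noted as a consequence.) Global minimum assumption: there exists at least one $x_*$ with $F(x_* )\le F(x)$ for all $x$.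
   Formalization: L-smoothness of each F_i is taken two-sided (absolute value, i.e. Lipschitz gradient), since the claim fails with the displayed upper inequality alone; unbiasedness of the stochastic gradients, E ∇f(x;z) = ∇F_i(x), is assumed explicitly, since without it the claim also fails. *)

theory Defs
  imports "HOL-Probability.Probability"
begin

definition nabla :: "('a::real_inner \<Rightarrow> real) \<Rightarrow> 'a \<Rightarrow> 'a" where
  "nabla h x = (THE v. GDERIV h x :> v)"

(* The quadratic bound is imposed from both sides, the usual meaning of "L-smooth" (for
   differentiable h and L > 0 it says that the gradient is L-Lipschitz).  The upper half alone
   also holds for every concave function, whose gradient may vary arbitrarily fast. *)
definition L_smooth :: "real \<Rightarrow> ('a::real_inner \<Rightarrow> real) \<Rightarrow> bool" where
  "L_smooth L h \<longleftrightarrow>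
     (\<forall>x. h differentiable (at x)) \<and>
     (\<forall>x y. \<bar>h y - h x - nabla h x \<bullet> (y - x)\<bar> \<le> L / 2 * (norm (y - x))\<^sup>2)"

definition approx_compressor :: "real \<Rightarrow> ('a::real_normed_vector \<Rightarrow> 'a) \<Rightarrow> bool" where
  "approx_compressor \<delta> C \<longleftrightarrow>
     0 \<le> \<delta> \<and> \<delta> \<le> 1 \<and> (\<forall>v. (norm (C v - v))\<^sup>2 \<le> (1 - \<delta>) * (norm v)\<^sup>2)"


definition local_obj :: "(nat \<Rightarrow> 'z measure) \<Rightarrow> ('a \<Rightarrow> 'z \<Rightarrow> real) \<Rightarrow> nat \<Rightarrow> 'a \<Rightarrow> real" where
  "local_obj D f i x = (\<integral>z. f x z \<partial>D i)"

definition global_obj :: "nat \<Rightarrow> (nat \<Rightarrow> 'z measure) \<Rightarrow> ('a \<Rightarrow> 'z \<Rightarrow> real) \<Rightarrow> 'a \<Rightarrow> real" where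
  "global_obj n D f x = (\<Sum>i\<in>{1..n}. local_obj D f i x) / real n"

definition loss_grad :: "('a::real_inner \<Rightarrow> 'z \<Rightarrow> real) \<Rightarrow> 'a \<Rightarrow> 'z \<Rightarrow> 'a" where
  "loss_grad f x z = nabla (\<lambda>y. f y z) x"

(* The last conjunct is what makes loss_grad a stochastic gradient: for a fresh sample it is an
   unbiased estimate of the local gradient.  Differentiability of f alone would not yield it. *)
definition distributed_data ::
    "nat \<Rightarrow> (nat \<Rightarrow> 'z measure) \<Rightarrow> ('a::euclidean_space \<Rightarrow> 'z \<Rightarrow> real) \<Rightarrow> bool" where
  "distributed_data n D f \<longleftrightarrow>
     (\<forall>i\<in>{1..n}. prob_space (D i)) \<and>
     (\<forall>i\<in>{1..n}. \<forall>j\<in>{1..n}. sets (D i) = sets (D j)) \<and>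
     inj_on D {1..n} \<and>
     (\<forall>i\<in>{1..n}. \<forall>x. integrable (D i) (f x)) \<and>
     (\<forall>i\<in>{1..n}. \<forall>z\<in>space (D i). \<forall>x. (\<lambda>y. f y z) differentiable (at x)) \<and>
     (\<forall>i\<in>{1..n}. \<forall>x. integrable (D i) (loss_grad f x) \<and>
        (\<integral>z. loss_grad f x z \<partial>D i) = nabla (local_obj D f i) x)"


definition psync :: "nat \<Rightarrow> ('a::real_vector \<Rightarrow> 'a) \<Rightarrow> (nat \<Rightarrow> 'a) \<Rightarrow> nat \<Rightarrow> 'a \<times> 'a" where
  "psync n C v i =
     (let r = v i - C (v i) in ((1 / real n) *\<^sub>R (\<Sum>k\<in>{1..n}. C (v k)) + r, r))"

(* One iteration t on the pair (x, e) of all workers' models and errors, for gradients g. *)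
definition cser_step ::
    "nat \<Rightarrow> nat \<Rightarrow> real \<Rightarrow> ('a::real_vector \<Rightarrow> 'a) \<Rightarrow> ('a \<Rightarrow> 'a) \<Rightarrow> nat \<Rightarrow> (nat \<Rightarrow> 'a)
       \<Rightarrow> (nat \<Rightarrow> 'a) \<times> (nat \<Rightarrow> 'a) \<Rightarrow> (nat \<Rightarrow> 'a) \<times> (nat \<Rightarrow> 'a)" where
  "cser_step n H \<eta> C1 C2 t g s =
     (let x = fst s; e = snd s;
          xh = (\<lambda>i. x i - \<eta> *\<^sub>R fst (psync n C2 g i));
          eh = (\<lambda>i. e i - \<eta> *\<^sub>R snd (psync n C2 g i))
      in if H dvd t
         then (\<lambda>i. xh i - eh i + fst (psync n C1 eh i), \<lambda>i. snd (psync n C1 eh i))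
         else (xh, eh))"

(* zs i t is the sample drawn by worker i in iteration t. *)
primrec cser ::
    "nat \<Rightarrow> nat \<Rightarrow> real \<Rightarrow> ('a::real_inner \<Rightarrow> 'a) \<Rightarrow> ('a \<Rightarrow> 'a) \<Rightarrow> ('a \<Rightarrow> 'z \<Rightarrow> real) \<Rightarrow> 'a
       \<Rightarrow> (nat \<Rightarrow> nat \<Rightarrow> 'z) \<Rightarrow> nat \<Rightarrow> (nat \<Rightarrow> 'a) \<times> (nat \<Rightarrow> 'a)" where
  "cser n H \<eta> C1 C2 f x0 zs 0 = (\<lambda>i. x0, \<lambda>i. 0)"
| "cser n H \<eta> C1 C2 f x0 zs (Suc t) =
     (let s = cser n H \<eta> C1 C2 f x0 zs t
      in cser_step n H \<eta> C1 C2 (Suc t) (\<lambda>i. loss_grad f (fst s i) (zs i (Suc t))) s)"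

definition iterate ::
    "nat \<Rightarrow> nat \<Rightarrow> real \<Rightarrow> ('a::real_inner \<Rightarrow> 'a) \<Rightarrow> ('a \<Rightarrow> 'a) \<Rightarrow> ('a \<Rightarrow> 'z \<Rightarrow> real) \<Rightarrow> 'a
       \<Rightarrow> (nat \<Rightarrow> nat \<Rightarrow> 'w \<Rightarrow> 'z) \<Rightarrow> nat \<Rightarrow> nat \<Rightarrow> 'w \<Rightarrow> 'a" where
  "iterate n H \<eta> C1 C2 f x0 Z i t \<omega> = fst (cser n H \<eta> C1 C2 f x0 (\<lambda>j s. Z j s \<omega>) t) i"

definition average :: "nat \<Rightarrow> (nat \<Rightarrow> nat \<Rightarrow> 'w \<Rightarrow> 'a::real_vector) \<Rightarrow> nat \<Rightarrow> 'w \<Rightarrow> 'a" where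
  "average n X t \<omega> = (1 / real n) *\<^sub>R (\<Sum>i\<in>{1..n}. X i t \<omega>)"


(* Independence of gradients is independence of the samples: the gradients of one iteration are
   evaluated at iterates with a common past, so they are only conditionally independent. *)
definition fresh_samples ::
    "'w measure \<Rightarrow> nat \<Rightarrow> nat \<Rightarrow> (nat \<Rightarrow> 'z measure) \<Rightarrow> (nat \<Rightarrow> nat \<Rightarrow> 'w \<Rightarrow> 'z) \<Rightarrow> bool" where
  "fresh_samples M n T D Z \<longleftrightarrow>
     prob_space M \<and>
     (\<forall>i\<in>{1..n}. \<forall>t\<in>{1..T}. Z i t \<in> measurable M (D i) \<and> distr M (D i) (Z i t) = D i) \<and>
     prob_space.indep_vars M (\<lambda>(i, t). D i) (\<lambda>(i, t). Z i t) ({1..n} \<times> {1..T})"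

(* The mean in the second bound is over the fresh sample only, with the current iterate fixed;
   the second-moment bound V1 + V1' would not follow if the iterate were averaged out as well. *)
definition gradient_bounds ::
    "'w measure \<Rightarrow> nat \<Rightarrow> nat \<Rightarrow> (nat \<Rightarrow> 'z measure) \<Rightarrow> ('a::euclidean_space \<Rightarrow> 'z \<Rightarrow> real)
       \<Rightarrow> (nat \<Rightarrow> nat \<Rightarrow> 'w \<Rightarrow> 'z) \<Rightarrow> (nat \<Rightarrow> nat \<Rightarrow> 'w \<Rightarrow> 'a) \<Rightarrow> real \<Rightarrow> real \<Rightarrow> bool" where
  "gradient_bounds M n T D f Z X V1 V1' \<longleftrightarrow>
     (\<forall>i\<in>{1..n}. \<forall>t\<in>{1..T}.
        (let dev = (\<lambda>\<omega>. (norm (loss_grad f (X i (t - 1) \<omega>) (Z i t \<omega>)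
                            - nabla (local_obj D f i) (X i (t - 1) \<omega>)))\<^sup>2)
         in integrable M dev \<and> integral\<^sup>L M dev \<le> V1) \<and>
        (AE \<omega> in M. (norm (\<integral>z. loss_grad f (X i (t - 1) \<omega>) z \<partial>D i))\<^sup>2 \<le> V1'))"


definition cser_factor :: "real \<Rightarrow> real \<Rightarrow> nat \<Rightarrow> real" where
  "cser_factor \<delta>1 \<delta>2 H =
     (4 * (1 - \<delta>1) / \<delta>1\<^sup>2 + 1) powr (1/3) * 2 powr (1/3) * (1 - \<delta>2) powr (1/3) * real H powr (2/3)"

definition cser_stepsize ::
    "real \<Rightarrow> real \<Rightarrow> nat \<Rightarrow> real \<Rightarrow> real \<Rightarrow> nat \<Rightarrow> nat \<Rightarrow> real" where
  "cser_stepsize \<delta>1 \<delta>2 H L \<gamma> n T =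
     min (\<gamma> / (sqrt (real T / real n) + cser_factor \<delta>1 \<delta>2 H * real T powr (1/3))) (1 / L)"

definition cser_bound ::
    "real \<Rightarrow> real \<Rightarrow> nat \<Rightarrow> real \<Rightarrow> real \<Rightarrow> real \<Rightarrow> real \<Rightarrow> real \<Rightarrow> nat \<Rightarrow> nat \<Rightarrow> real" where
  "cser_bound \<delta>1 \<delta>2 H L V1 V2 \<gamma> Fo n T =
     1 / sqrt (real n * real T) * (Fo / \<gamma> + \<gamma> * L * V1)
     + cser_factor \<delta>1 \<delta>2 H / real T powr (2/3) * (Fo / \<gamma> + \<gamma>\<^sup>2 * L\<^sup>2 * V2)"

end

(* Averaging over the workers removes the compression error: the mean iterate moves by the plain mean
   gradient, and each worker deviates from it only by its deviation from the mean local error e.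
   Between two resets e collects at most H compression residuals; a reset contracts it.  Young's
   inequality turns this into E|e|^2 <= B^3 eta^2 V2, where B is cser_factor.

   L-smoothness gives, path by path, a descent inequality for F along the mean iterate whose only
   term of indefinite sign is linear in the noise of the fresh samples.  Given all other samples this
   noise is centred, so the term vanishes in expectation and the mean noise has variance at most V1/n.
   Summing over t before taking expectations avoids integrability of F along the iterates.
   The step size balances eta against n/T and B^3 eta^2. *)

theory Submission
  imports Defs
begin

subsection \<open>Gradients\<close>

text \<open>The obstacle is measurability and conditioning: nothing is assumed about joint
  measurability of the stochastic gradient in model and sample, and the noise is multiplied by
  vectors that may depend on every other sample, those of the same iteration included.
  Differentiability in the model makes the gradient jointly measurable. Conditioning is replaced by
  Fubini over the \<sigma>-algebra generated by all samples but one; hence measurability of the run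
  is proved relative to an arbitrary measure space on which the samples involved are measurable.

  Deviations reduce to errors because a residual enters the model and the error of its worker in the
  same way. In B^3 = 2 * (4 * (1 - \<delta>1) / \<delta>1^2 + 1) * H^2 * (1 - \<delta>2), the
  fraction bounds the fixed point of the contraction at resets, the 1 stands for the unfinished
  block after the last reset, the 2 comes from joining these two, and H^2 from adding up H residuals
  that need not be centred. The error term B^3 \<eta>^2 competes with 1 / (\<eta> T), which brings
  the cube root of T into the step size.\<close>

lemma nabla_eqI:
  fixes h :: "'a::real_inner \<Rightarrow> real"
  assumes "GDERIV h x :> v"
  shows "nabla h x = v"
proof -
  have "w = v" if "GDERIV h x :> w" for w
  proof -
    have "(\<lambda>y. y \<bullet> w) = (\<lambda>y. y \<bullet> v)"
      using that assms unfolding gderiv_def by (rule has_derivative_unique)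
    then have "(w - v) \<bullet> w = (w - v) \<bullet> v"
      by metis
    then have "(w - v) \<bullet> (w - v) = 0"
      by (simp add: inner_diff_right)
    then show ?thesis
      by simp
  qed
  then show ?thesis
    unfolding nabla_def using assms by (intro the_equality)
qed

lemma GDERIV_nabla:
  fixes h :: "'a::euclidean_space \<Rightarrow> real"
  assumes "h differentiable (at x)"
  shows "GDERIV h x :> nabla h x"
proof -
  from assms obtain h' where h': "(h has_derivative h') (at x)"
    unfolding differentiable_def by blast
  then have lin: "linear h'"
    by (rule has_derivative_linear)
  \<comment> \<open>Riesz representative of \<open>h'\<close>: its coordinates are the values of
    \<open>h'\<close> on the basis.\<close>
  define v where "v = (\<Sum>b\<in>Basis. h' b *\<^sub>R b)"
  have "h' y = y \<bullet> v" for y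
  proof -
    have "h' y = h' (\<Sum>b\<in>Basis. (y \<bullet> b) *\<^sub>R b)"
      by (simp add: euclidean_representation)
    also have "\<dots> = (\<Sum>b\<in>Basis. (y \<bullet> b) * h' b)"
      by (simp add: linear_sum[OF lin] linear_cmul[OF lin])
    also have "\<dots> = y \<bullet> v"
      by (simp add: v_def inner_sum_right mult.commute)
    finally show ?thesis .
  qed
  then have "h' = (\<lambda>y. y \<bullet> v)"
    by auto
  with h' have "GDERIV h x :> v"
    by (simp add: gderiv_def)
  then show ?thesis
    by (simp add: nabla_eqI)
qed

lemma GDERIV_mean:
  fixes g :: "nat \<Rightarrow> 'a::euclidean_space \<Rightarrow> real"
  assumes "\<And>i. i \<in> {1..n} \<Longrightarrow> g i differentiable (at x)"
  shows "GDERIV (\<lambda>y. (\<Sum>i\<in>{1..n}. g i y) / real n) x :> (1 / real n) *\<^sub>R (\<Sum>i\<in>{1..n}. nabla (g i) x)"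
proof -
  have "((\<lambda>y. (\<Sum>i\<in>{1..n}. g i y) / real n) has_derivative
      (\<lambda>h. (\<Sum>i\<in>{1..n}. h \<bullet> nabla (g i) x) / real n)) (at x)"
    using GDERIV_nabla[OF assms] unfolding gderiv_def
    by (intro bounded_linear.has_derivative[OF bounded_linear_divide] has_derivative_sum) auto
  moreover have "(\<lambda>h. (\<Sum>i\<in>{1..n}. h \<bullet> nabla (g i) x) / real n)
      = (\<lambda>h. h \<bullet> ((1 / real n) *\<^sub>R (\<Sum>i\<in>{1..n}. nabla (g i) x)))"
    by (auto simp: inner_sum_right fun_eq_iff)
  ultimately show ?thesis
    unfolding gderiv_def by simp
qed

text \<open>The quadratic bound is used between each of \<open>x\<close>, \<open>y\<close> and each
  of the two points \<open>m + u\<close>, \<open>m - u\<close> placed symmetrically about the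
  midpoint \<open>m\<close>. With upper and lower halves combined, all values of \<open>h\<close>
  cancel and only the gradient difference tested against \<open>u\<close> remains. The parallelogram
  law keeps the constant at \<open>L\<close>.\<close>

lemma L_smooth_nabla_lipschitz:
  fixes h :: "'a::real_inner \<Rightarrow> real"
  assumes L: "L_smooth L h"
  shows "norm (nabla h y - nabla h x) \<le> L * norm (y - x)"
proof (cases "x = y \<or> nabla h y = nabla h x")
  case True
  \<comment> \<open>For distinct points the bound itself provides the sign of
    \<open>L\<close>.\<close>
  have "0 \<le> \<bar>h y - h x - nabla h x \<bullet> (y - x)\<bar>"
    by simp
  also have "\<dots> \<le> L / 2 * (norm (y - x))\<^sup>2"
    using L unfolding L_smooth_def by blast
  finally have "0 \<le> L * norm (y - x)"
    by (cases "x = y") (auto simp: zero_le_mult_iff)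
  with True show ?thesis
    by auto
next
  case False
  define G where "G = nabla h y - nabla h x"
  define m where "m = (1/2) *\<^sub>R (x + y)"
  define d where "d = (1/2) *\<^sub>R (y - x)"
  \<comment> \<open>\<open>u\<close> points along the gradient difference, so that the inner product
    with it is a product of norms; its length is that of \<open>d\<close>, which balances the two
    sides of the final estimate.\<close>
  define u where "u = (norm d / norm G) *\<^sub>R G"
  have G0: "norm G > 0" and d0: "norm d > 0"
    using False by (auto simp: G_def d_def)
  have u: "norm u = norm d" "G \<bullet> u = norm G * norm d"
    using G0 by (auto simp: u_def power2_norm_eq_inner[symmetric] power2_eq_square)
  have bd: "\<bar>h b - h a - nabla h a \<bullet> (b - a)\<bar> \<le> L / 2 * (norm (b - a))\<^sup>2" for a b
    using L unfolding L_smooth_def by blast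
  have par: "(norm (d + u))\<^sup>2 + (norm (u - d))\<^sup>2 = 4 * (norm d)\<^sup>2"
  proof -
    have "(norm (d + u))\<^sup>2 + (norm (u - d))\<^sup>2 = 2 * (norm u)\<^sup>2 + 2 * (norm d)\<^sup>2"
      by (simp add: power2_norm_eq_inner inner_add_left inner_diff_left inner_add_right inner_diff_right)
    with u show ?thesis by simp
  qed
  have xy: "x = m - d" "y = m + d"
    unfolding m_def d_def by (auto simp: algebra_simps simp flip: scaleR_left_distrib)
  have n: "m + u - x = d + u" "m + u - y = u - d" "m - u - x = d - u" "m - u - y = - (d + u)"
    by (simp_all add: xy)
  have sq: "(norm (d - u))\<^sup>2 = (norm (u - d))\<^sup>2"
    by (simp add: norm_minus_commute)
  have "2 * (G \<bullet> u) = (nabla h y \<bullet> (u - d) - nabla h x \<bullet> (d + u))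
      + (nabla h x \<bullet> (d - u) - nabla h y \<bullet> (- (d + u)))"
    by (simp add: G_def inner_diff_left inner_diff_right inner_add_right)
  also have "\<dots> \<le> L / 2 * ((norm (d + u))\<^sup>2 + (norm (u - d))\<^sup>2)
      + L / 2 * ((norm (u - d))\<^sup>2 + (norm (d + u))\<^sup>2)"
    using bd[where b="m + u" and a=x] bd[where b="m + u" and a=y] bd[where b="m - u" and a=x] bd[where b="m - u" and a=y]
    unfolding n sq norm_minus_cancel abs_le_iff distrib_left by linarith
  also have "\<dots> = 4 * L * (norm d)\<^sup>2"
    unfolding par add.commute[of "(norm (u - d))\<^sup>2"] by simp
  finally have "norm G * norm d \<le> 2 * L * norm d * norm d"
    using u by (simp add: power2_eq_square)
  then have "norm G \<le> 2 * L * norm d"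
    using d0 by simp
  also have "\<dots> = L * norm (y - x)"
    by (simp add: d_def)
  finally show ?thesis
    by (simp add: G_def)
qed

lemma L_smooth_mean:
  fixes g :: "nat \<Rightarrow> 'a::euclidean_space \<Rightarrow> real"
  assumes "1 \<le> n" and g: "\<And>i. i \<in> {1..n} \<Longrightarrow> L_smooth L (g i)"
  shows "L_smooth L (\<lambda>x. (\<Sum>i\<in>{1..n}. g i x) / real n)"
    and "nabla (\<lambda>x. (\<Sum>i\<in>{1..n}. g i x) / real n) x = (1 / real n) *\<^sub>R (\<Sum>i\<in>{1..n}. nabla (g i) x)"
proof -
  let ?G = "\<lambda>x. (\<Sum>i\<in>{1..n}. g i x) / real n"
  have diff: "g i differentiable (at x)" if "i \<in> {1..n}" for i x
    using g[OF that] by (auto simp: L_smooth_def)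
  have grad: "GDERIV ?G x :> (1 / real n) *\<^sub>R (\<Sum>i\<in>{1..n}. nabla (g i) x)" for x
    using diff by (intro GDERIV_mean) auto
  then show nab: "nabla ?G x = (1 / real n) *\<^sub>R (\<Sum>i\<in>{1..n}. nabla (g i) x)" for x
    by (rule nabla_eqI)
  have "?G differentiable (at x)" for x
    using grad[of x] unfolding gderiv_def differentiable_def by blast
  moreover have "\<bar>?G y - ?G x - nabla ?G x \<bullet> (y - x)\<bar> \<le> L / 2 * (norm (y - x))\<^sup>2" for x y
  proof -
    have "?G y - ?G x - nabla ?G x \<bullet> (y - x)
        = (\<Sum>i\<in>{1..n}. g i y - g i x - nabla (g i) x \<bullet> (y - x)) / real n"
      unfolding nab by (simp add: sum_subtractf inner_sum_left diff_divide_distrib)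
    also have "\<bar>\<dots>\<bar> \<le> (\<Sum>i\<in>{1..n}. \<bar>g i y - g i x - nabla (g i) x \<bullet> (y - x)\<bar>) / real n"
      by (simp add: divide_right_mono)
    also have "\<dots> \<le> (\<Sum>i\<in>{1..n}. L / 2 * (norm (y - x))\<^sup>2) / real n"
      using g unfolding L_smooth_def by (intro divide_right_mono sum_mono) auto
    also have "\<dots> = L / 2 * (norm (y - x))\<^sup>2"
      using \<open>1 \<le> n\<close> by simp
    finally show ?thesis .
  qed
  ultimately show "L_smooth L ?G"
    unfolding L_smooth_def by blast
qed

lemma L_smooth_nabla_measurable:
  fixes h :: "'a::euclidean_space \<Rightarrow> real"
  assumes "L_smooth L h"
  shows "nabla h \<in> borel_measurable borel"
proof -
  \<comment> \<open>The absolute value is there because \<open>lipschitz_on\<close> asks for a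
    nonnegative constant.\<close>
  have "(\<bar>L\<bar>)-lipschitz_on UNIV (nabla h)"
  proof (rule lipschitz_onI)
    fix x y :: 'a
    have "norm (nabla h x - nabla h y) \<le> L * norm (x - y)"
      using L_smooth_nabla_lipschitz[OF assms] .
    also have "\<dots> \<le> \<bar>L\<bar> * norm (x - y)"
      by (simp add: mult_right_mono)
    finally show "dist (nabla h x) (nabla h y) \<le> \<bar>L\<bar> * dist x y"
      by (simp add: dist_norm)
  qed auto
  then have "continuous_on UNIV (nabla h)"
    by (rule lipschitz_on_continuous_on)
  then show ?thesis
    by (rule borel_measurable_continuous_onI)
qed

section \<open>Joint measurability of stochastic gradients\<close>

text \<open>Simple functions \<open>s i\<close> approximate the first argument. With finitely many
  values there, joint measurability follows from that of the sections \<open>f x\<close>; continuity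
  in \<open>x\<close> carries it to the limit.\<close>

lemma borel_measurable_caratheodory:
  fixes f :: "'a::{second_countable_topology, metric_space} \<Rightarrow> 'z \<Rightarrow> real"
  assumes meas: "\<And>x. f x \<in> borel_measurable D"
    and cont: "\<And>z. z \<in> space D \<Longrightarrow> continuous_on UNIV (\<lambda>x. f x z)"
  shows "(\<lambda>(x, z). f x z) \<in> borel_measurable (borel \<Otimes>\<^sub>M D)"
proof -
  obtain s :: "nat \<Rightarrow> 'a \<Rightarrow> 'a" where s: "\<And>i. simple_function borel (s i)"
    and lim: "\<And>x. (\<lambda>i. s i x) \<longlonglongrightarrow> x"
    using borel_measurable_implies_sequence_metric[of "\<lambda>x::'a. x" borel undefined] by auto
  have step: "(\<lambda>p. f (s i (fst p)) (snd p)) \<in> borel_measurable (borel \<Otimes>\<^sub>M D)" for i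
  proof (rule measurable_compose_countable'[where I = "range (s i)"])
    show "(\<lambda>p. f x (snd p)) \<in> borel_measurable (borel \<Otimes>\<^sub>M D)" for x
      using meas by measurable
    have "s i \<in> borel \<rightarrow>\<^sub>M count_space (range (s i))"
      using s[of i] by (simp add: measurable_simple_function measurable_count_space_eq2 simple_function_def)
    then show "(\<lambda>p. s i (fst p)) \<in> borel \<Otimes>\<^sub>M D \<rightarrow>\<^sub>M count_space (range (s i))"
      by measurable
    show "countable (range (s i))"
      using s[of i] by (simp add: simple_function_def countable_finite)
  qed
  show ?thesis
  proof (rule borel_measurable_LIMSEQ_metric[OF step])
    fix p assume "p \<in> space (borel \<Otimes>\<^sub>M D :: ('a \<times> 'z) measure)"
    then have "isCont (\<lambda>x. f x (snd p)) (fst p)"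
      using cont by (auto simp: space_pair_measure continuous_on_eq_continuous_at)
    then show "(\<lambda>i. f (s i (fst p)) (snd p)) \<longlonglongrightarrow> (case p of (x, z) \<Rightarrow> f x z)"
      using lim by (auto simp: case_prod_unfold intro: isCont_tendsto_compose)
  qed
qed

text \<open>Each coordinate of the gradient is the pointwise limit of difference quotients with
  increments \<open>1 / (k + 1)\<close> along a basis vector, and these are jointly measurable by
  the preceding lemma.\<close>

lemma loss_grad_measurable:
  fixes f :: "'a::euclidean_space \<Rightarrow> 'z \<Rightarrow> real"
  assumes meas: "\<And>x. f x \<in> borel_measurable D"
    and diff: "\<And>x z. z \<in> space D \<Longrightarrow> (\<lambda>y. f y z) differentiable (at x)"
  shows "(\<lambda>(x, z). loss_grad f x z) \<in> borel_measurable (borel \<Otimes>\<^sub>M D)"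
proof (subst borel_measurable_euclidean_space, intro ballI)
  fix b :: 'a assume b: "b \<in> Basis"
  have "(\<lambda>(x, z). f x z) \<in> borel_measurable (borel \<Otimes>\<^sub>M D)"
    using meas diff
    by (intro borel_measurable_caratheodory) (auto simp: continuous_on_eq_continuous_at differentiable_imp_continuous_within)
  then have [measurable]: "(\<lambda>p. f (fst p) (snd p)) \<in> borel_measurable (borel \<Otimes>\<^sub>M D)"
    by (simp add: case_prod_unfold)
  define h where "h k = inverse (real (Suc k))" for k
  define q where "q k p = (f (fst p + h k *\<^sub>R b) (snd p) - f (fst p) (snd p)) / h k" for k p
  have "(\<lambda>p. (fst p + h k *\<^sub>R b, snd p)) \<in> borel \<Otimes>\<^sub>M D \<rightarrow>\<^sub>M borel \<Otimes>\<^sub>M D" for k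
    by measurable
  from measurable_compose[OF this \<open>(\<lambda>p. f (fst p) (snd p)) \<in> borel_measurable _\<close>]
  have [measurable]: "(\<lambda>p. f (fst p + h k *\<^sub>R b) (snd p)) \<in> borel_measurable (borel \<Otimes>\<^sub>M D)" for k
    by simp
  show "(\<lambda>p. (case p of (x, z) \<Rightarrow> loss_grad f x z) \<bullet> b) \<in> borel_measurable (borel \<Otimes>\<^sub>M D)"
  proof (rule borel_measurable_LIMSEQ_metric)
    show "q k \<in> borel_measurable (borel \<Otimes>\<^sub>M D)" for k
      unfolding q_def by measurable
    fix p assume "p \<in> space (borel \<Otimes>\<^sub>M D :: ('a \<times> 'z) measure)"
    then obtain x z where p: "p = (x, z)" and z: "z \<in> space D"
      by (auto simp: space_pair_measure)
    have "GDERIV (\<lambda>y. f y z) x :> loss_grad f x z"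
      unfolding loss_grad_def using diff[OF z] by (rule GDERIV_nabla)
    then have "((\<lambda>y. f y z) has_derivative (\<lambda>h. h \<bullet> loss_grad f x z)) (at (x + 0 *\<^sub>R b))"
      by (simp add: gderiv_def)
    moreover have "((\<lambda>s::real. x + s *\<^sub>R b) has_derivative (\<lambda>s. s *\<^sub>R b)) (at 0)"
      by (auto intro!: derivative_eq_intros)
    ultimately have "((\<lambda>s::real. f (x + s *\<^sub>R b) z) has_derivative (\<lambda>s. s *\<^sub>R b \<bullet> loss_grad f x z)) (at 0)"
      using has_derivative_compose by fast
    then have "DERIV (\<lambda>s. f (x + s *\<^sub>R b) z) 0 :> loss_grad f x z \<bullet> b"
      by (simp add: has_field_derivative_def inner_commute mult.commute[of _ "b \<bullet> _"] mult_commute_abs)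
    then have "(\<lambda>s. (f (x + s *\<^sub>R b) z - f x z) / s) \<midarrow>0\<rightarrow> loss_grad f x z \<bullet> b"
      by (simp add: DERIV_def)
    moreover have "filterlim h (at 0) sequentially"
      unfolding h_def filterlim_at using LIMSEQ_inverse_real_of_nat by auto
    ultimately have "(\<lambda>k. (f (x + h k *\<^sub>R b) z - f x z) / h k) \<longlonglongrightarrow> loss_grad f x z \<bullet> b"
      by (rule filterlim_compose)
    then show "(\<lambda>k. q k p) \<longlonglongrightarrow> (case p of (x, z) \<Rightarrow> loss_grad f x z) \<bullet> b"
      by (simp add: q_def p)
  qed
qed

lemma norm_sum_power2_le:
  fixes v :: "'i \<Rightarrow> 'a::real_normed_vector"
  shows "(norm (\<Sum>i\<in>I. v i))\<^sup>2 \<le> real (card I) * (\<Sum>i\<in>I. (norm (v i))\<^sup>2)"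
proof -
  have "(norm (\<Sum>i\<in>I. v i))\<^sup>2 \<le> (\<Sum>i\<in>I. norm (v i))\<^sup>2"
    by (intro power_mono norm_sum) auto
  also have "\<dots> \<le> real (card I) * (\<Sum>i\<in>I. (norm (v i))\<^sup>2)"
    using sum_squared_le_sum_of_squares[where I = I and f = "\<lambda>i. norm (v i)"]
    by (cases "finite I") (auto simp: mult.commute)
  finally show ?thesis .
qed

subsection \<open>Square-integrable random vectors\<close>

text \<open>Measurability of the vector is part of the notion, since integrability of its squared
  norm would not imply it.\<close>

definition sq_integrable :: "'w measure \<Rightarrow> ('w \<Rightarrow> 'a::euclidean_space) \<Rightarrow> bool" where
  "sq_integrable M u \<longleftrightarrow> u \<in> borel_measurable M \<and> integrable M (\<lambda>\<omega>. (norm (u \<omega>))\<^sup>2)"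

lemma sq_integrable_AE_bound:
  assumes "u \<in> borel_measurable M" "integrable M h" "AE \<omega> in M. (norm (u \<omega>))\<^sup>2 \<le> h \<omega>"
  shows "sq_integrable M u"
  unfolding sq_integrable_def
proof
  show "integrable M (\<lambda>\<omega>. (norm (u \<omega>))\<^sup>2)"
    using assms(2) by (rule Bochner_Integration.integrable_bound) (use assms in auto)
qed fact

lemma sq_integrable_norm_le:
  assumes "u \<in> borel_measurable M" "sq_integrable M v" "\<And>\<omega>. norm (u \<omega>) \<le> norm (v \<omega>)"
  shows "sq_integrable M u"
proof (rule sq_integrable_AE_bound)
  show "integrable M (\<lambda>\<omega>. (norm (v \<omega>))\<^sup>2)"
    using assms unfolding sq_integrable_def by blast
qed (use assms in \<open>auto intro: power_mono\<close>)

lemma norm_add_power2_le: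
  fixes a b :: "'a::real_inner"
  shows "(norm (a + b))\<^sup>2 \<le> 2 * (norm a)\<^sup>2 + 2 * (norm b)\<^sup>2"
proof -
  have "2 * (norm a)\<^sup>2 + 2 * (norm b)\<^sup>2 - (norm (a + b))\<^sup>2 = (norm (a - b))\<^sup>2"
    by (simp add: power2_norm_eq_inner inner_add_left inner_add_right inner_diff_left inner_diff_right)
  then show ?thesis
    by (metis diff_ge_0_iff_ge zero_le_power2)
qed

lemma sq_integrable_scaleR:
  assumes "sq_integrable M u"
  shows "sq_integrable M (\<lambda>\<omega>. c *\<^sub>R u \<omega>)"
  using assms unfolding sq_integrable_def by (auto simp: power_mult_distrib)

lemma sq_integrable_add:
  assumes "sq_integrable M u" "sq_integrable M v"
  shows "sq_integrable M (\<lambda>\<omega>. u \<omega> + v \<omega>)"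
proof (rule sq_integrable_AE_bound)
  show "integrable M (\<lambda>\<omega>. 2 * (norm (u \<omega>))\<^sup>2 + 2 * (norm (v \<omega>))\<^sup>2)"
    using assms unfolding sq_integrable_def by auto
qed (use assms in \<open>auto simp: sq_integrable_def norm_add_power2_le\<close>)

lemma sq_integrable_diff:
  assumes "sq_integrable M u" "sq_integrable M v"
  shows "sq_integrable M (\<lambda>\<omega>. u \<omega> - v \<omega>)"
  using sq_integrable_add[OF assms(1) sq_integrable_scaleR[OF assms(2), of "-1"]] by simp

lemma sq_integrable_zero: "sq_integrable M (\<lambda>\<omega>. 0)"
  by (simp add: sq_integrable_def)

lemma sq_integrable_sum:
  assumes "\<And>i. i \<in> I \<Longrightarrow> sq_integrable M (u i)"
  shows "sq_integrable M (\<lambda>\<omega>. \<Sum>i\<in>I. u i \<omega>)"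
  using assms
  by (induction I rule: infinite_finite_induct) (auto intro: sq_integrable_add simp: sq_integrable_zero)

text \<open>Polarization: the inner product is a combination of squared norms, each of them
  integrable.\<close>

lemma sq_integrable_inner:
  assumes "sq_integrable M u" "sq_integrable M v"
  shows "integrable M (\<lambda>\<omega>. u \<omega> \<bullet> v \<omega>)"
proof -
  have eq: "(\<lambda>\<omega>. u \<omega> \<bullet> v \<omega>) = (\<lambda>\<omega>. ((norm (u \<omega> + v \<omega>))\<^sup>2 - (norm (u \<omega>))\<^sup>2 - (norm (v \<omega>))\<^sup>2) / 2)"
    by (simp add: fun_eq_iff power2_norm_eq_inner inner_add_left inner_add_right inner_commute)
  show ?thesis
    unfolding eq using assms sq_integrable_add[OF assms] by (auto simp: sq_integrable_def)
qed

lemmas sq_integrable_intros =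
  sq_integrable_scaleR sq_integrable_add sq_integrable_diff sq_integrable_sum sq_integrable_zero

subsection \<open>Independence of a fresh sample from the past\<close>

context prob_space
begin

text \<open>\<open>N\<close> is the \<sigma>-algebra on \<open>space M\<close> generated by all
  \<open>W j\<close> with \<open>j\<close> other than \<open>k\<close>. The identity into
  \<open>N\<close> thus acts as one random variable carrying all the other samples, and independence
  becomes a product law, the form in which Fubini applies.\<close>

lemma indep_vars_past:
  assumes ind: "indep_vars D W I" and k: "k \<in> I"
  obtains N where "\<And>j. j \<in> I - {k} \<Longrightarrow> W j \<in> N \<rightarrow>\<^sub>M D j"
    and "random_variable N (\<lambda>\<omega>. \<omega>)" "random_variable (D k) (W k)"
    and "distr M N (\<lambda>\<omega>. \<omega>) \<Otimes>\<^sub>M distr M (D k) (W k) = distr M (N \<Otimes>\<^sub>M D k) (\<lambda>\<omega>. (\<omega>, W k \<omega>))"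
proof -
  define P where "P = PiM (I - {k}) D"
  define Y where "Y \<omega> = restrict (\<lambda>i. W i \<omega>) (I - {k})" for \<omega>
  define N where "N = vimage_algebra (space M) Y P"
  have W: "random_variable (D j) (W j)" if "j \<in> I" for j
    using ind that unfolding indep_vars_def by blast
  have "indep_var P Y (PiM {k} D) (\<lambda>\<omega>. restrict (\<lambda>i. W i \<omega>) {k})"
    unfolding P_def Y_def using k by (intro indep_var_restrict[OF ind]) auto
  then have PY: "indep_var P Y (PiM {k} D) (\<lambda>\<omega>. restrict (\<lambda>i. W i \<omega>) {k})" .
  have Y: "random_variable P Y"
    using PY by (rule indep_var_rv1)
  have Y_space: "Y \<in> space M \<rightarrow> space P"
    using Y by (auto dest: measurable_space)
  have spN: "space N = space M"
    by (simp add: N_def)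
  have setsN: "sets N = {Y -` A \<inter> space M | A. A \<in> sets P}"
    unfolding N_def using Y_space by (rule sets_vimage_algebra2)
  have rvN: "random_variable N (\<lambda>\<omega>. \<omega>)"
    unfolding measurable_def using setsN spN measurable_sets[OF Y] sets.sets_into_space
    by (auto simp: Int_absorb2)
  have prod: "emeasure M (A \<inter> (W k -` B \<inter> space M)) = emeasure M A * emeasure M (W k -` B \<inter> space M)"
    if A: "A \<in> sets N" and B: "B \<in> sets (D k)" for A B
  proof -
    from A obtain A' where A': "A' \<in> sets P" "A = Y -` A' \<inter> space M"
      using setsN by blast
    \<comment> \<open>Independence is available for families restricted to index sets, so an event
      for \<open>W k\<close> has to be written as a cylinder over the one-point index set.\<close>
    define B' where "B' = (\<lambda>y. y k) -` B \<inter> space (PiM {k} D)"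
    have B': "B' \<in> sets (PiM {k} D)"
      unfolding B'_def using B by (intro measurable_sets[OF measurable_component_singleton]) auto
    have pre: "(\<lambda>\<omega>. restrict (\<lambda>i. W i \<omega>) {k}) -` B' \<inter> space M = W k -` B \<inter> space M"
      unfolding B'_def using measurable_space[OF W[OF k]] by (auto simp: space_PiM)
    have "prob (A \<inter> (W k -` B \<inter> space M)) =
        prob ((\<lambda>\<omega>. (Y \<omega>, restrict (\<lambda>i. W i \<omega>) {k})) -` (A' \<times> B') \<inter> space M)"
      unfolding A'(2) pre[symmetric] by (rule arg_cong[where f = prob]) auto
    also have "\<dots> = prob A * prob (W k -` B \<inter> space M)"
      using indep_varD[OF PY A'(1) B'] unfolding A'(2) pre by simp
    finally show ?thesis
      by (simp add: emeasure_eq_measure ennreal_mult')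
  qed
  interpret N: prob_space "distr M N (\<lambda>\<omega>. \<omega>)"
    using rvN by (rule prob_space_distr)
  interpret Dk: prob_space "distr M (D k) (W k)"
    using W[OF k] by (rule prob_space_distr)
  have pair: "(\<lambda>\<omega>. (\<omega>, W k \<omega>)) \<in> M \<rightarrow>\<^sub>M N \<Otimes>\<^sub>M D k"
    using rvN W[OF k] by measurable
  have "distr M N (\<lambda>\<omega>. \<omega>) \<Otimes>\<^sub>M distr M (D k) (W k) = distr M (N \<Otimes>\<^sub>M D k) (\<lambda>\<omega>. (\<omega>, W k \<omega>))"
  proof (rule pair_measure_eqI)
    fix A B assume "A \<in> sets (distr M N (\<lambda>\<omega>. \<omega>))" "B \<in> sets (distr M (D k) (W k))"
    then have A: "A \<in> sets N" and B: "B \<in> sets (D k)"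
      by simp_all
    have AM: "A \<subseteq> space M"
      using sets.sets_into_space[OF A] spN by simp
    have "(\<lambda>\<omega>. (\<omega>, W k \<omega>)) -` (A \<times> B) \<inter> space M = A \<inter> (W k -` B \<inter> space M)"
      by auto
    moreover have "(\<lambda>\<omega>. \<omega>) -` A \<inter> space M = A"
      using AM by auto
    ultimately show "emeasure (distr M N (\<lambda>\<omega>. \<omega>)) A * emeasure (distr M (D k) (W k)) B =
        emeasure (distr M (N \<Otimes>\<^sub>M D k) (\<lambda>\<omega>. (\<omega>, W k \<omega>))) (A \<times> B)"
      using prod[OF A B] A B W[OF k] by (simp add: emeasure_distr rvN pair)
  qed (auto intro: N.sigma_finite_measure Dk.sigma_finite_measure)
  moreover have "W j \<in> N \<rightarrow>\<^sub>M D j" if "j \<in> I - {k}" for j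
  proof -
    have "(\<lambda>\<omega>. Y \<omega> j) \<in> N \<rightarrow>\<^sub>M D j"
    proof (rule measurable_compose[of Y N P "\<lambda>y. y j"])
      show "Y \<in> N \<rightarrow>\<^sub>M P"
        unfolding N_def using Y_space by (rule measurable_vimage_algebra1)
      show "(\<lambda>y. y j) \<in> P \<rightarrow>\<^sub>M D j"
        unfolding P_def using that by simp
    qed
    then show ?thesis
      using that by (simp add: Y_def)
  qed
  ultimately show thesis
    using that rvN W[OF k] by blast
qed

text \<open>A conditional expectation in disguise: under the product law the point of
  \<open>N\<close> is frozen, which fixes both \<open>\<phi>\<close> and the model \<open>u\<close>,
  and the remaining integral over the fresh sample vanishes by unbiasedness. Square integrability
  supplies the integrability that Fubini requires.\<close>

lemma fresh_sample_orthogonal: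
  fixes \<phi> u :: "'a \<Rightarrow> 'b::euclidean_space" and G :: "'b \<Rightarrow> 'z \<Rightarrow> 'b"
  assumes rv: "random_variable N (\<lambda>\<omega>. \<omega>)" "random_variable D W"
    and joint: "distr M N (\<lambda>\<omega>. \<omega>) \<Otimes>\<^sub>M D = distr M (N \<Otimes>\<^sub>M D) (\<lambda>\<omega>. (\<omega>, W \<omega>))"
    and dW: "distr M D W = D"
    and G: "(\<lambda>(x, z). G x z) \<in> borel_measurable (borel \<Otimes>\<^sub>M D)"
    and m: "m \<in> borel_measurable borel"
    and unbiased: "\<And>x. integrable D (G x)" "\<And>x. (\<integral>z. G x z \<partial>D) = m x"
    and u: "u \<in> borel_measurable N" and \<phi>: "\<phi> \<in> borel_measurable N"
    and sq: "sq_integrable M \<phi>" "sq_integrable M (\<lambda>\<omega>. G (u \<omega>) (W \<omega>) - m (u \<omega>))"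
  shows "expectation (\<lambda>\<omega>. \<phi> \<omega> \<bullet> (G (u \<omega>) (W \<omega>) - m (u \<omega>))) = 0"
proof -
  define P where "P = distr M N (\<lambda>\<omega>. \<omega>)"
  define \<psi> where "\<psi> p = \<phi> (fst p) \<bullet> (G (u (fst p)) (snd p) - m (u (fst p)))" for p
  note joint = joint[folded P_def]
  interpret P: prob_space P
    unfolding P_def using rv(1) by (rule prob_space_distr)
  interpret D: prob_space D
    using prob_space_distr[OF rv(2)] dW by simp
  interpret PD: pair_sigma_finite P D ..
  have pair: "(\<lambda>\<omega>. (\<omega>, W \<omega>)) \<in> M \<rightarrow>\<^sub>M N \<Otimes>\<^sub>M D"
    using rv by measurable
  have "(\<lambda>p. (u (fst p), snd p)) \<in> N \<Otimes>\<^sub>M D \<rightarrow>\<^sub>M borel \<Otimes>\<^sub>M D"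
    using u by measurable
  from measurable_compose[OF this G]
  have "(\<lambda>p. G (u (fst p)) (snd p)) \<in> borel_measurable (N \<Otimes>\<^sub>M D)"
    by simp
  moreover have "(\<lambda>p. m (u (fst p))) \<in> borel_measurable (N \<Otimes>\<^sub>M D)"
    using u m by measurable
  ultimately have \<psi>: "\<psi> \<in> borel_measurable (N \<Otimes>\<^sub>M D)"
    unfolding \<psi>_def using \<phi> by measurable
  have "integrable M (\<lambda>\<omega>. \<psi> (\<omega>, W \<omega>))"
    unfolding \<psi>_def using sq_integrable_inner[OF sq] by simp
  then have int: "integrable (P \<Otimes>\<^sub>M D) \<psi>"
    unfolding joint using integrable_distr_eq[OF pair \<psi>] by simp
  have "expectation (\<lambda>\<omega>. \<phi> \<omega> \<bullet> (G (u \<omega>) (W \<omega>) - m (u \<omega>))) = expectation (\<lambda>\<omega>. \<psi> (\<omega>, W \<omega>))"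
    by (simp add: \<psi>_def)
  also have "\<dots> = integral\<^sup>L (P \<Otimes>\<^sub>M D) \<psi>"
    unfolding joint using integral_distr[OF pair \<psi>] by simp
  also have "\<dots> = (\<integral>\<omega>. (\<integral>z. \<psi> (\<omega>, z) \<partial>D) \<partial>P)"
    using PD.integral_fst'[OF int] by simp
  \<comment> \<open>This holds for every \<open>\<omega>\<close>, because unbiasedness is available
    at every fixed model.\<close>
  also have "(\<lambda>\<omega>. \<integral>z. \<psi> (\<omega>, z) \<partial>D) = (\<lambda>\<omega>. 0)"
  proof
    fix \<omega>
    have "(\<integral>z. \<psi> (\<omega>, z) \<partial>D) = \<phi> \<omega> \<bullet> (\<integral>z. G (u \<omega>) z - m (u \<omega>) \<partial>D)"
      unfolding \<psi>_def using unbiased(1) by simp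
    also have "\<dots> = 0"
      using unbiased by (simp add: D.prob_space)
    finally show "(\<integral>z. \<psi> (\<omega>, z) \<partial>D) = 0" .
  qed
  finally show ?thesis
    by simp
qed

end

subsection \<open>Averages over the workers\<close>

text \<open>\<open>average\<close> is tied to processes indexed by worker, time and outcome; this
  version takes any family indexed by workers, such as gradients, errors or noises at one
  time.\<close>

definition mean :: "nat \<Rightarrow> (nat \<Rightarrow> 'a::real_vector) \<Rightarrow> 'a" where
  "mean n v = (1 / real n) *\<^sub>R (\<Sum>i\<in>{1..n}. v i)"

lemma mean_add: "mean n (\<lambda>i. u i + v i) = mean n u + mean n v"
  by (simp add: mean_def sum.distrib scaleR_add_right)

lemma mean_diff: "mean n (\<lambda>i. u i - v i) = mean n u - mean n v"
  by (simp add: mean_def sum_subtractf scaleR_diff_right)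

lemma mean_scaleR: "mean n (\<lambda>i. c *\<^sub>R v i) = c *\<^sub>R mean n v"
  by (simp add: mean_def scaleR_sum_right mult.commute)

lemma mean_const: "1 \<le> n \<Longrightarrow> mean n (\<lambda>i. c) = c"
  by (simp add: mean_def sum_constant_scaleR)

lemma norm_mean_power2_le:
  fixes v :: "nat \<Rightarrow> 'a::real_normed_vector"
  assumes "1 \<le> n"
  shows "(norm (mean n v))\<^sup>2 \<le> (\<Sum>i\<in>{1..n}. (norm (v i))\<^sup>2) / real n"
proof -
  have "(norm (mean n v))\<^sup>2 = (norm (\<Sum>i\<in>{1..n}. v i))\<^sup>2 / (real n)\<^sup>2"
    by (simp add: mean_def power_divide)
  also have "\<dots> \<le> real n * (\<Sum>i\<in>{1..n}. (norm (v i))\<^sup>2) / (real n)\<^sup>2"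
    using norm_sum_power2_le[of v "{1..n}"] by (intro divide_right_mono) auto
  also have "\<dots> = (\<Sum>i\<in>{1..n}. (norm (v i))\<^sup>2) / real n"
    using assms by (simp add: power2_eq_square)
  finally show ?thesis .
qed

text \<open>The variance identity: the two sides differ by \<open>n\<close> times the squared norm
  of the mean.\<close>

lemma sum_norm_diff_mean_le:
  fixes v :: "nat \<Rightarrow> 'a::real_inner"
  assumes "1 \<le> n"
  shows "(\<Sum>i\<in>{1..n}. (norm (v i - mean n v))\<^sup>2) \<le> (\<Sum>i\<in>{1..n}. (norm (v i))\<^sup>2)"
proof -
  let ?m = "mean n v"
  have s: "(\<Sum>i\<in>{1..n}. v i) = real n *\<^sub>R ?m"
    using assms by (simp add: mean_def)
  have "(\<Sum>i\<in>{1..n}. (norm (v i - ?m))\<^sup>2)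
      = (\<Sum>i\<in>{1..n}. (norm (v i))\<^sup>2 + (norm ?m)\<^sup>2 - 2 * (v i \<bullet> ?m))"
    by (intro sum.cong) (simp_all add: power2_norm_eq_inner inner_diff_left inner_diff_right inner_commute)
  also have "\<dots> = (\<Sum>i\<in>{1..n}. (norm (v i))\<^sup>2) + real n * (norm ?m)\<^sup>2 - 2 * ((\<Sum>i\<in>{1..n}. v i) \<bullet> ?m)"
    by (simp add: sum.distrib sum_subtractf inner_sum_left sum_distrib_left)
  also have "\<dots> = (\<Sum>i\<in>{1..n}. (norm (v i))\<^sup>2) - real n * (norm ?m)\<^sup>2"
    unfolding s by (simp add: power2_norm_eq_inner)
  finally show ?thesis
    by simp
qed

lemma sq_integrable_mean:
  assumes "\<And>i. i \<in> {1..n} \<Longrightarrow> sq_integrable M (u i)"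
  shows "sq_integrable M (\<lambda>\<omega>. mean n (\<lambda>i. u i \<omega>))"
  unfolding mean_def using assms by (intro sq_integrable_intros)

lemma borel_measurable_mean:
  fixes u :: "nat \<Rightarrow> 'w \<Rightarrow> 'a::euclidean_space"
  assumes "\<And>i. i \<in> {1..n} \<Longrightarrow> u i \<in> borel_measurable M"
  shows "(\<lambda>\<omega>. mean n (\<lambda>i. u i \<omega>)) \<in> borel_measurable M"
  unfolding mean_def using assms by (intro borel_measurable_scaleR borel_measurable_sum) auto

lemma psync_mean:
  "fst (psync n C v i) = mean n (\<lambda>k. C (v k)) + (v i - C (v i))"
  "snd (psync n C v i) = v i - C (v i)"
  by (simp_all add: psync_def mean_def Let_def)

text \<open>This cruder form, without the factor \<open>1 - \<delta>\<close>, transfers square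
  integrability from a vector to its residual.\<close>

lemma approx_compressor_norm_le:
  assumes "approx_compressor \<delta> C"
  shows "norm (v - C v) \<le> norm v"
proof -
  have "(norm (v - C v))\<^sup>2 \<le> (1 - \<delta>) * (norm v)\<^sup>2"
    using assms by (simp add: approx_compressor_def norm_minus_commute)
  also have "\<dots> \<le> (norm v)\<^sup>2"
    using assms by (intro mult_left_le_one_le) (auto simp: approx_compressor_def)
  finally show ?thesis
    by (rule power2_le_imp_le) simp
qed

text \<open>The contraction of a reset step: the Young weights are chosen such that the factor
  \<open>1 - \<delta>\<close> still leaves a contraction by \<open>1 - \<delta> / 2\<close> of the old error.\<close>

lemma weighted_young:
  fixes a b :: "'a::real_inner" and \<delta> :: real
  assumes "0 < \<delta>" "\<delta> \<le> 1"
  shows "(1 - \<delta>) * (norm (a + b))\<^sup>2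
    \<le> (1 - \<delta> / 2) * (norm a)\<^sup>2 + (1 - \<delta>) * (2 - \<delta>) / \<delta> * (norm b)\<^sup>2"
proof -
  \<comment> \<open>Chosen so that the squared norm of \<open>w\<close> is
    \<open>2 * \<delta>\<close> times the difference of the two sides of the claim.\<close>
  define w where "w = \<delta> *\<^sub>R a - (2 * (1 - \<delta>)) *\<^sub>R b"
  have e: "(norm (a + b))\<^sup>2 = (norm a)\<^sup>2 + 2 * (a \<bullet> b) + (norm b)\<^sup>2"
    by (simp add: power2_norm_eq_inner inner_add_left inner_add_right inner_commute)
  have "(norm w)\<^sup>2 = \<delta>\<^sup>2 * (norm a)\<^sup>2 - 4 * \<delta> * (1 - \<delta>) * (a \<bullet> b) + 4 * (1 - \<delta>)\<^sup>2 * (norm b)\<^sup>2"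
    unfolding w_def power2_norm_eq_inner
    by (simp add: inner_commute power2_eq_square algebra_simps)
  then have "0 \<le> \<delta>\<^sup>2 * (norm a)\<^sup>2 - 4 * \<delta> * (1 - \<delta>) * (a \<bullet> b) + 4 * (1 - \<delta>)\<^sup>2 * (norm b)\<^sup>2"
    by (metis zero_le_power2)
  also have "\<dots> = 2 * \<delta> * ((1 - \<delta> / 2) * (norm a)\<^sup>2 + (1 - \<delta>) * (2 - \<delta>) / \<delta> * (norm b)\<^sup>2
      - (1 - \<delta>) * (norm (a + b))\<^sup>2)"
    using assms unfolding e by (simp add: field_simps power2_eq_square)
  finally show ?thesis
    using assms by (simp add: zero_le_mult_iff)
qed

subsection \<open>Paths of the algorithm\<close>

text \<open>The step size is any nonnegative \<open>\<eta>\<close> with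
  \<open>\<eta> * L \<le> 1\<close>; its formula matters only when the summed bound is turned into a
  rate.\<close>

locale cser_run = prob_space M for M :: "'w measure" +
  fixes n T H :: nat and L \<eta> \<delta>1 \<delta>2 V1 V1' :: real
    and C1 C2 :: "'a::euclidean_space \<Rightarrow> 'a"
    and D :: "nat \<Rightarrow> 'z measure" and f :: "'a \<Rightarrow> 'z \<Rightarrow> real"
    and Z :: "nat \<Rightarrow> nat \<Rightarrow> 'w \<Rightarrow> 'z" and x0 :: 'a
  assumes n: "1 \<le> n" and H: "0 < H" and \<delta>1: "0 < \<delta>1"
    and \<eta>: "0 \<le> \<eta>" "\<eta> * L \<le> 1" and L: "0 \<le> L"
    and C1: "approx_compressor \<delta>1 C1" "C1 \<in> borel_measurable borel"
    and C2: "approx_compressor \<delta>2 C2" "C2 \<in> borel_measurable borel"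
    and data: "distributed_data n D f"
    and smooth: "\<And>i. i \<in> {1..n} \<Longrightarrow> L_smooth L (local_obj D f i)"
    and fresh: "fresh_samples M n T D Z"
    and bounds: "gradient_bounds M n T D f Z (iterate n H \<eta> C1 C2 f x0 Z) V1 V1'"
begin

abbreviation "x \<equiv> iterate n H \<eta> C1 C2 f x0 Z"
abbreviation "xbar \<equiv> average n x"
abbreviation "F \<equiv> global_obj n D f"
abbreviation "gF i \<equiv> nabla (local_obj D f i)"

definition e :: "nat \<Rightarrow> nat \<Rightarrow> 'w \<Rightarrow> 'a" where
  "e i t \<omega> = snd (cser n H \<eta> C1 C2 f x0 (\<lambda>j s. Z j s \<omega>) t) i"

text \<open>Time is shifted by one against the algorithm: \<open>g i t\<close> is the gradient of
  iteration \<open>t + 1\<close>, taken at the model with index \<open>t\<close>. The same shift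
  applies to \<open>dev\<close> and \<open>res\<close>.\<close>

definition g :: "nat \<Rightarrow> nat \<Rightarrow> 'w \<Rightarrow> 'a" where
  "g i t \<omega> = loss_grad f (x i t \<omega>) (Z i (Suc t) \<omega>)"

definition dev :: "nat \<Rightarrow> nat \<Rightarrow> 'w \<Rightarrow> 'a" where
  "dev i t \<omega> = g i t \<omega> - gF i (x i t \<omega>)"

definition res :: "nat \<Rightarrow> nat \<Rightarrow> 'w \<Rightarrow> 'a" where
  "res i t \<omega> = g i t \<omega> - C2 (g i t \<omega>)"

lemma \<delta>_bounds: "\<delta>1 \<le> 1" "0 \<le> \<delta>2" "\<delta>2 \<le> 1"
  using C1 C2 by (auto simp: approx_compressor_def)

lemma x_0: "x i 0 \<omega> = x0" and e_0: "e i 0 \<omega> = 0"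
  by (simp_all add: iterate_def e_def)

lemma cser_eq: "cser n H \<eta> C1 C2 f x0 (\<lambda>j s. Z j s \<omega>) t = (\<lambda>i. x i t \<omega>, \<lambda>i. e i t \<omega>)"
  by (simp add: iterate_def e_def)

lemma cser_Suc_eq:
  "cser n H \<eta> C1 C2 f x0 (\<lambda>j s. Z j s \<omega>) (Suc t)
    = cser_step n H \<eta> C1 C2 (Suc t) (\<lambda>i. g i t \<omega>) (\<lambda>i. x i t \<omega>, \<lambda>i. e i t \<omega>)"
  by (simp add: cser_eq Let_def g_def)

lemma e_Suc:
  "e i (Suc t) \<omega> = (if H dvd Suc t
     then (e i t \<omega> - \<eta> *\<^sub>R res i t \<omega>) - C1 (e i t \<omega> - \<eta> *\<^sub>R res i t \<omega>)
     else e i t \<omega> - \<eta> *\<^sub>R res i t \<omega>)"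
  unfolding e_def[of i "Suc t"] cser_Suc_eq
  by (simp add: cser_step_def Let_def psync_mean res_def)

lemma x_Suc:
  "x i (Suc t) \<omega> = x i t \<omega> - \<eta> *\<^sub>R (mean n (\<lambda>k. C2 (g k t \<omega>)) + res i t \<omega>)
    + (if H dvd Suc t then mean n (\<lambda>k. C1 (e k t \<omega> - \<eta> *\<^sub>R res k t \<omega>)) - C1 (e i t \<omega> - \<eta> *\<^sub>R res i t \<omega>)
       else 0)"
  unfolding iterate_def[of _ _ _ _ _ _ _ _ _ "Suc t"] cser_Suc_eq
  by (simp add: cser_step_def Let_def psync_mean res_def)

lemma xbar_mean: "xbar t \<omega> = mean n (\<lambda>i. x i t \<omega>)"
  by (simp add: average_def mean_def)

text \<open>Synchronization gives every worker the same compressed mean, and the local remainder is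
  recorded identically in model and error. The difference therefore never becomes worker
  dependent.\<close>

lemma x_minus_e: "\<exists>y. \<forall>i. x i t \<omega> - e i t \<omega> = y"
proof (induction t)
  case 0
  then show ?case
    by (simp add: x_0 e_0)
next
  case (Suc t)
  then obtain y where y: "\<And>i. x i t \<omega> = y + e i t \<omega>"
    by (auto simp: diff_eq_eq)
  show ?case
    \<comment> \<open>The witness moves the old common value by the shared terms alone: the mean
      compressed gradient and, at a reset, the mean compressed error.\<close>
    by (rule exI[where x = "y - \<eta> *\<^sub>R mean n (\<lambda>k. C2 (g k t \<omega>))
          + (if H dvd Suc t then mean n (\<lambda>k. C1 (e k t \<omega> - \<eta> *\<^sub>R res k t \<omega>)) else 0)"])
       (simp add: x_Suc e_Suc y algebra_simps)
qed

lemma x_minus_xbar: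
  "x i t \<omega> - xbar t \<omega> = e i t \<omega> - mean n (\<lambda>i. e i t \<omega>)"
proof -
  obtain y where y: "\<And>i. x i t \<omega> = y + e i t \<omega>"
    using x_minus_e[of t \<omega>] by (auto simp: diff_eq_eq)
  show ?thesis
    unfolding xbar_mean y using n by (simp add: mean_add mean_const)
qed

lemma xbar_0: "xbar 0 \<omega> = x0"
  using n by (simp add: xbar_mean x_0 mean_const)

text \<open>Partial synchronization preserves the mean over the workers, whatever the compressor:
  what compression removes from a vector is added back locally. A reset consequently leaves the mean
  iterate unchanged.\<close>

lemma xbar_Suc: "xbar (Suc t) \<omega> = xbar t \<omega> - \<eta> *\<^sub>R mean n (\<lambda>i. g i t \<omega>)"
  unfolding xbar_mean x_Suc
  using n by (cases "H dvd Suc t")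
    (simp_all add: mean_add mean_diff mean_scaleR mean_const res_def)

lemma L_smooth_F: "L_smooth L F"
  and nabla_F: "nabla F y = mean n (\<lambda>i. gF i y)"
  using L_smooth_mean[OF n, of L "local_obj D f"] smooth
  by (simp_all add: global_obj_def[abs_def] mean_def)

text \<open>Lipschitz continuity is applied to each local objective separately;
  \<open>x_minus_xbar\<close> turns model deviations into error deviations, and subtracting the mean
  error only decreases the sum of squares.\<close>

lemma nabla_F_deviation:
  "(norm (nabla F (xbar t \<omega>) - mean n (\<lambda>i. gF i (x i t \<omega>))))\<^sup>2
    \<le> L\<^sup>2 * ((\<Sum>i\<in>{1..n}. (norm (e i t \<omega>))\<^sup>2) / real n)"
proof -
  have "(norm (nabla F (xbar t \<omega>) - mean n (\<lambda>i. gF i (x i t \<omega>))))\<^sup>2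
      = (norm (mean n (\<lambda>i. gF i (xbar t \<omega>) - gF i (x i t \<omega>))))\<^sup>2"
    by (simp add: nabla_F mean_diff)
  also have "\<dots> \<le> (\<Sum>i\<in>{1..n}. (norm (gF i (xbar t \<omega>) - gF i (x i t \<omega>)))\<^sup>2) / real n"
    by (rule norm_mean_power2_le[OF n])
  also have "\<dots> \<le> (\<Sum>i\<in>{1..n}. L\<^sup>2 * (norm (e i t \<omega> - mean n (\<lambda>i. e i t \<omega>)))\<^sup>2) / real n"
  proof (intro divide_right_mono sum_mono)
    fix i assume "i \<in> {1..n}"
    then have "norm (gF i (xbar t \<omega>) - gF i (x i t \<omega>)) \<le> L * norm (e i t \<omega> - mean n (\<lambda>i. e i t \<omega>))"
      using L_smooth_nabla_lipschitz[OF smooth, of i "xbar t \<omega>" "x i t \<omega>"]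
      by (simp add: x_minus_xbar[symmetric] norm_minus_commute)
    then show "(norm (gF i (xbar t \<omega>) - gF i (x i t \<omega>)))\<^sup>2 \<le> L\<^sup>2 * (norm (e i t \<omega> - mean n (\<lambda>i. e i t \<omega>)))\<^sup>2"
      by (metis norm_ge_zero power_mono power_mult_distrib)
  qed simp
  also have "\<dots> = L\<^sup>2 * ((\<Sum>i\<in>{1..n}. (norm (e i t \<omega> - mean n (\<lambda>i. e i t \<omega>)))\<^sup>2) / real n)"
    by (simp add: sum_distrib_left)
  also have "\<dots> \<le> L\<^sup>2 * ((\<Sum>i\<in>{1..n}. (norm (e i t \<omega>))\<^sup>2) / real n)"
    by (intro mult_left_mono divide_right_mono sum_norm_diff_mean_le[OF n]) auto
  finally show ?thesis .
qed

text \<open>The mean gradient is split into the mean \<open>b\<close> of the local gradients and the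
  noise \<open>d\<close>. The coefficient of the linear noise term involves only models with index
  \<open>t\<close>, which is what makes \<open>dev_orthogonal\<close> applicable to it.\<close>

lemma descent:
  "F (xbar (Suc t) \<omega>) \<le> F (xbar t \<omega>) - \<eta> / 2 * (norm (nabla F (xbar t \<omega>)))\<^sup>2
    + \<eta> / 2 * (L\<^sup>2 * ((\<Sum>i\<in>{1..n}. (norm (e i t \<omega>))\<^sup>2) / real n))
    + L * \<eta>\<^sup>2 / 2 * (norm (mean n (\<lambda>i. dev i t \<omega>)))\<^sup>2
    + ((L * \<eta>\<^sup>2) *\<^sub>R mean n (\<lambda>i. gF i (x i t \<omega>)) - \<eta> *\<^sub>R nabla F (xbar t \<omega>)) \<bullet> mean n (\<lambda>i. dev i t \<omega>)"
proof -
  define a b d where "a = nabla F (xbar t \<omega>)" and "b = mean n (\<lambda>i. gF i (x i t \<omega>))"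
    and "d = mean n (\<lambda>i. dev i t \<omega>)"
  have bd: "mean n (\<lambda>i. g i t \<omega>) = b + d"
    by (simp add: b_def d_def dev_def mean_diff)
  have "F (xbar (Suc t) \<omega>) \<le> F (xbar t \<omega>) + a \<bullet> (xbar (Suc t) \<omega> - xbar t \<omega>)
      + L / 2 * (norm (xbar (Suc t) \<omega> - xbar t \<omega>))\<^sup>2"
    using L_smooth_F unfolding L_smooth_def a_def by (smt (verit))
  also have "\<dots> = F (xbar t \<omega>) - \<eta> * (a \<bullet> b + a \<bullet> d) + L * \<eta>\<^sup>2 / 2 * (norm (b + d))\<^sup>2"
    by (simp add: xbar_Suc bd inner_add_right power_mult_distrib)
  \<comment> \<open>Polarization of the inner product of \<open>a\<close> and \<open>b\<close>
    produces the wanted square of \<open>a\<close>; the negative square of \<open>b\<close> absorbs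
    the one from the smoothness term, since \<open>\<eta> * L \<le> 1\<close>.\<close>
  also have "\<dots> = F (xbar t \<omega>) - \<eta> / 2 * (norm a)\<^sup>2 + \<eta> / 2 * (norm (a - b))\<^sup>2
      - (\<eta> - L * \<eta>\<^sup>2) / 2 * (norm b)\<^sup>2 + L * \<eta>\<^sup>2 / 2 * (norm d)\<^sup>2
      + ((L * \<eta>\<^sup>2) *\<^sub>R b - \<eta> *\<^sub>R a) \<bullet> d"
  proof -
    have 1: "(norm (b + d))\<^sup>2 = (norm b)\<^sup>2 + 2 * (b \<bullet> d) + (norm d)\<^sup>2"
      and 2: "(norm (a - b))\<^sup>2 = (norm a)\<^sup>2 - 2 * (a \<bullet> b) + (norm b)\<^sup>2"
      by (simp_all add: power2_norm_eq_inner inner_add_left inner_add_right inner_diff_left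
          inner_diff_right inner_commute)
    show ?thesis
      unfolding 1 2 by (simp add: inner_diff_left field_simps)
  qed
  also have "\<dots> \<le> F (xbar t \<omega>) - \<eta> / 2 * (norm a)\<^sup>2
      + \<eta> / 2 * (L\<^sup>2 * ((\<Sum>i\<in>{1..n}. (norm (e i t \<omega>))\<^sup>2) / real n))
      + L * \<eta>\<^sup>2 / 2 * (norm d)\<^sup>2 + ((L * \<eta>\<^sup>2) *\<^sub>R b - \<eta> *\<^sub>R a) \<bullet> d"
  proof -
    have "L * \<eta>\<^sup>2 = \<eta> * (\<eta> * L)"
      by (simp add: power2_eq_square)
    also have "\<dots> \<le> \<eta>"
      using \<eta> by (simp add: mult_left_le)
    finally have "0 \<le> (\<eta> - L * \<eta>\<^sup>2) / 2 * (norm b)\<^sup>2"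
      by simp
    moreover have "\<eta> / 2 * (norm (a - b))\<^sup>2 \<le> \<eta> / 2 * (L\<^sup>2 * ((\<Sum>i\<in>{1..n}. (norm (e i t \<omega>))\<^sup>2) / real n))"
      using \<eta> nabla_F_deviation unfolding a_def b_def by (intro mult_left_mono) auto
    ultimately show ?thesis
      by linarith
  qed
  finally show ?thesis
    by (simp add: a_def b_def d_def)
qed

subsection \<open>Moments\<close>

lemma sample: "i \<in> {1..n} \<Longrightarrow> t \<in> {1..T} \<Longrightarrow> Z i t \<in> M \<rightarrow>\<^sub>M D i"
  and distr_sample: "i \<in> {1..n} \<Longrightarrow> t \<in> {1..T} \<Longrightarrow> distr M (D i) (Z i t) = D i"
  using fresh by (auto simp: fresh_samples_def)

lemma loss_grad_meas:
  assumes "i \<in> {1..n}"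
  shows "(\<lambda>(x, z). loss_grad f x z) \<in> borel_measurable (borel \<Otimes>\<^sub>M D i)"
  using data assms unfolding distributed_data_def
  by (intro loss_grad_measurable) (auto intro: borel_measurable_integrable)

lemma gF_meas: "i \<in> {1..n} \<Longrightarrow> gF i \<in> borel_measurable borel"
  using smooth L_smooth_nabla_measurable by blast

lemma g_meas:
  assumes "i \<in> {1..n}" "x i t \<in> borel_measurable N" "Z i (Suc t) \<in> N \<rightarrow>\<^sub>M D i"
  shows "g i t \<in> borel_measurable N"
proof -
  have "(\<lambda>\<omega>. (x i t \<omega>, Z i (Suc t) \<omega>)) \<in> N \<rightarrow>\<^sub>M borel \<Otimes>\<^sub>M D i"
    using assms by measurable
  from measurable_compose[OF this loss_grad_meas[OF assms(1)]] show ?thesis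
    by (simp add: g_def[abs_def])
qed

text \<open>\<open>N\<close> is left free because the lemma serves twice: with \<open>M\<close>
  itself, and with the \<sigma>-algebra that omits one sample of iteration \<open>t + 1\<close>.
  Only samples up to iteration \<open>t\<close> enter.\<close>

lemma run_measurable:
  assumes "\<And>j s. j \<in> {1..n} \<Longrightarrow> s \<in> {1..t} \<Longrightarrow> Z j s \<in> N \<rightarrow>\<^sub>M D j" and "i \<in> {1..n}"
  shows "x i t \<in> borel_measurable N" and "e i t \<in> borel_measurable N"
proof -
  have "\<forall>i\<in>{1..n}. x i t \<in> borel_measurable N \<and> e i t \<in> borel_measurable N"
    using assms(1)
  proof (induction t)
    case 0
    then show ?case
      by (simp add: x_0[abs_def] e_0[abs_def])
  next
    case (Suc t)
    then have xe: "x i t \<in> borel_measurable N" "e i t \<in> borel_measurable N" if "i \<in> {1..n}" for i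
      using that by auto
    have g: "g i t \<in> borel_measurable N" if "i \<in> {1..n}" for i
      using g_meas[OF that xe(1)[OF that]] Suc.prems that by auto
    have C2g: "(\<lambda>\<omega>. C2 (g i t \<omega>)) \<in> borel_measurable N" if "i \<in> {1..n}" for i
      using measurable_compose[OF g[OF that] C2(2)] .
    have res: "res i t \<in> borel_measurable N" if "i \<in> {1..n}" for i
      unfolding res_def[abs_def] using g[OF that] C2g[OF that] by measurable
    have eh: "(\<lambda>\<omega>. e i t \<omega> - \<eta> *\<^sub>R res i t \<omega>) \<in> borel_measurable N" if "i \<in> {1..n}" for i
      using xe[OF that] res[OF that] by measurable
    have C1e: "(\<lambda>\<omega>. C1 (e i t \<omega> - \<eta> *\<^sub>R res i t \<omega>)) \<in> borel_measurable N" if "i \<in> {1..n}" for i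
      using measurable_compose[OF eh[OF that] C1(2)] .
    have [measurable]: "(\<lambda>\<omega>. mean n (\<lambda>k. C2 (g k t \<omega>))) \<in> borel_measurable N"
      "(\<lambda>\<omega>. mean n (\<lambda>k. C1 (e k t \<omega> - \<eta> *\<^sub>R res k t \<omega>))) \<in> borel_measurable N"
      using C2g C1e by (auto intro!: borel_measurable_mean)
    show ?case
    proof (intro ballI conjI)
      fix i assume i: "i \<in> {1..n}"
      note [measurable] = xe[OF i] res[OF i] C1e[OF i]
      show "x i (Suc t) \<in> borel_measurable N" "e i (Suc t) \<in> borel_measurable N"
        unfolding x_Suc[abs_def] e_Suc[abs_def] by (cases "H dvd Suc t"; simp)+
    qed
  qed
  with assms(2) show "x i t \<in> borel_measurable N" and "e i t \<in> borel_measurable N"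
    by auto
qed

lemma run_random_variable:
  assumes "i \<in> {1..n}" "t \<le> T"
  shows "random_variable borel (x i t)" "random_variable borel (e i t)"
  using assms sample by (auto intro!: run_measurable)

lemma g_random_variable:
  assumes "i \<in> {1..n}" "t < T"
  shows "random_variable borel (g i t)"
  using assms sample run_random_variable by (auto intro!: g_meas)

text \<open>The gradient assumption in the shifted index. Unbiasedness identifies the mean over a
  fresh sample with \<open>gF i\<close>, so the second bound controls the local gradients along the
  run.\<close>

lemma bounds_Suc:
  assumes "i \<in> {1..n}" "t < T"
  shows "integrable M (\<lambda>\<omega>. (norm (dev i t \<omega>))\<^sup>2) \<and> expectation (\<lambda>\<omega>. (norm (dev i t \<omega>))\<^sup>2) \<le> V1"
    and "AE \<omega> in M. (norm (gF i (x i t \<omega>)))\<^sup>2 \<le> V1'"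
proof -
  have "(\<integral>z. loss_grad f y z \<partial>D i) = gF i y" for y
    using data assms unfolding distributed_data_def by blast
  then show "integrable M (\<lambda>\<omega>. (norm (dev i t \<omega>))\<^sup>2) \<and> expectation (\<lambda>\<omega>. (norm (dev i t \<omega>))\<^sup>2) \<le> V1"
    and "AE \<omega> in M. (norm (gF i (x i t \<omega>)))\<^sup>2 \<le> V1'"
    using bounds[unfolded gradient_bounds_def Let_def, THEN bspec[where x = i], THEN bspec[where x = "Suc t"]] assms
    by (simp_all add: dev_def g_def)
qed

lemma dev_sq_integrable:
  assumes "i \<in> {1..n}" "t < T"
  shows "sq_integrable M (dev i t)" and "expectation (\<lambda>\<omega>. (norm (dev i t \<omega>))\<^sup>2) \<le> V1"
proof -
  have "(\<lambda>\<omega>. gF i (x i t \<omega>)) \<in> borel_measurable M"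
    using measurable_compose[OF run_random_variable(1) gF_meas] assms by simp
  then have "dev i t \<in> borel_measurable M"
    unfolding dev_def[abs_def] using g_random_variable[OF assms] by measurable
  then show "sq_integrable M (dev i t)" "expectation (\<lambda>\<omega>. (norm (dev i t \<omega>))\<^sup>2) \<le> V1"
    using bounds_Suc(1)[OF assms] by (auto simp: sq_integrable_def)
qed

lemma gF_sq_integrable:
  assumes "i \<in> {1..n}" "t < T"
  shows "sq_integrable M (\<lambda>\<omega>. gF i (x i t \<omega>))"
    and "expectation (\<lambda>\<omega>. (norm (gF i (x i t \<omega>)))\<^sup>2) \<le> V1'"
proof -
  note AE = bounds_Suc(2)[OF assms]
  have "(\<lambda>\<omega>. gF i (x i t \<omega>)) \<in> borel_measurable M"
    using measurable_compose[OF run_random_variable(1) gF_meas] assms by simp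
  then show sq: "sq_integrable M (\<lambda>\<omega>. gF i (x i t \<omega>))"
    by (rule sq_integrable_AE_bound[OF _ _ AE]) simp
  show "expectation (\<lambda>\<omega>. (norm (gF i (x i t \<omega>)))\<^sup>2) \<le> V1'"
    using sq AE by (intro integral_le_const) (auto simp: sq_integrable_def)
qed

section \<open>Orthogonality of the noise and second moments\<close>

text \<open>The condition on \<open>\<phi>\<close> says, without naming a \<sigma>-algebra, that it
  is determined by all samples except the one behind \<open>dev i t\<close>. This covers functions
  of the past as well as the noise of another worker in the same iteration.\<close>

lemma dev_orthogonal:
  fixes \<phi> :: "'w \<Rightarrow> 'a"
  assumes i: "i \<in> {1..n}" and t: "t < T" and sq: "sq_integrable M \<phi>"
    and \<phi>: "\<And>N. (\<And>j s. j \<in> {1..n} \<Longrightarrow> s \<in> {1..T} \<Longrightarrow> (j, s) \<noteq> (i, Suc t) \<Longrightarrow> Z j s \<in> N \<rightarrow>\<^sub>M D j)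
        \<Longrightarrow> \<phi> \<in> borel_measurable N"
  shows "expectation (\<lambda>\<omega>. \<phi> \<omega> \<bullet> dev i t \<omega>) = 0"
proof -
  have ind: "indep_vars (\<lambda>(i, t). D i) (\<lambda>(i, t). Z i t) ({1..n} \<times> {1..T})"
    using fresh by (simp add: fresh_samples_def)
  have "(i, Suc t) \<in> {1..n} \<times> {1..T}"
    using i t by auto
  from indep_vars_past[OF ind this] obtain N where
    N: "\<And>j. j \<in> {1..n} \<times> {1..T} - {(i, Suc t)} \<Longrightarrow> (case j of (i, t) \<Rightarrow> Z i t) \<in> N \<rightarrow>\<^sub>M (case j of (i, t) \<Rightarrow> D i)"
    and rv: "random_variable N (\<lambda>\<omega>. \<omega>)" "random_variable (D i) (Z i (Suc t))"
    and joint: "distr M N (\<lambda>\<omega>. \<omega>) \<Otimes>\<^sub>M distr M (D i) (Z i (Suc t))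
      = distr M (N \<Otimes>\<^sub>M D i) (\<lambda>\<omega>. (\<omega>, Z i (Suc t) \<omega>))"
    by auto
  have dZ: "distr M (D i) (Z i (Suc t)) = D i"
    using distr_sample i t by simp
  have past: "Z j s \<in> N \<rightarrow>\<^sub>M D j" if "j \<in> {1..n}" "s \<in> {1..T}" "(j, s) \<noteq> (i, Suc t)" for j s
    using N[of "(j, s)"] that by auto
  have "expectation (\<lambda>\<omega>. \<phi> \<omega> \<bullet> (loss_grad f (x i t \<omega>) (Z i (Suc t) \<omega>) - gF i (x i t \<omega>))) = 0"
  proof (rule fresh_sample_orthogonal[OF rv joint[unfolded dZ] dZ loss_grad_meas[OF i] gF_meas[OF i]])
    show "integrable (D i) (loss_grad f y)" "(\<integral>z. loss_grad f y z \<partial>D i) = gF i y" for y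
      using data i unfolding distributed_data_def by blast+
    show "x i t \<in> borel_measurable N"
      using i t by (intro run_measurable past) auto
    show "\<phi> \<in> borel_measurable N"
      using past by (rule \<phi>)
    show "sq_integrable M (\<lambda>\<omega>. loss_grad f (x i t \<omega>) (Z i (Suc t) \<omega>) - gF i (x i t \<omega>))"
      using dev_sq_integrable(1)[OF i t] unfolding dev_def[abs_def] g_def[abs_def] .
  qed (rule sq)
  then show ?thesis
    by (simp add: dev_def g_def)
qed

text \<open>Bias-variance decomposition: the local gradient is orthogonal to the noise, so the two
  bounds add up with no extra factor.\<close>

lemma g_sq_integrable:
  assumes i: "i \<in> {1..n}" and t: "t < T"
  shows "sq_integrable M (g i t)" and "expectation (\<lambda>\<omega>. (norm (g i t \<omega>))\<^sup>2) \<le> V1 + V1'"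
proof -
  note d = dev_sq_integrable[OF i t] and G = gF_sq_integrable[OF i t]
  have g: "g i t \<omega> = gF i (x i t \<omega>) + dev i t \<omega>" for \<omega>
    by (simp add: dev_def)
  show "sq_integrable M (g i t)"
    unfolding g[abs_def] using d G by (intro sq_integrable_intros)
  have "expectation (\<lambda>\<omega>. gF i (x i t \<omega>) \<bullet> dev i t \<omega>) = 0"
  proof (rule dev_orthogonal[OF i t G(1)])
    fix N :: "'w measure"
    assume "\<And>j s. j \<in> {1..n} \<Longrightarrow> s \<in> {1..T} \<Longrightarrow> (j, s) \<noteq> (i, Suc t) \<Longrightarrow> Z j s \<in> N \<rightarrow>\<^sub>M D j"
    then have "x i t \<in> borel_measurable N"
      using i t by (intro run_measurable) auto
    from measurable_compose[OF this gF_meas[OF i]] show "(\<lambda>\<omega>. gF i (x i t \<omega>)) \<in> borel_measurable N" .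
  qed
  moreover have "(norm (g i t \<omega>))\<^sup>2 = (norm (gF i (x i t \<omega>)))\<^sup>2 + 2 * (gF i (x i t \<omega>) \<bullet> dev i t \<omega>)
      + (norm (dev i t \<omega>))\<^sup>2" for \<omega>
    unfolding g by (simp add: power2_norm_eq_inner inner_add_left inner_add_right inner_commute)
  ultimately have "expectation (\<lambda>\<omega>. (norm (g i t \<omega>))\<^sup>2)
      = expectation (\<lambda>\<omega>. (norm (gF i (x i t \<omega>)))\<^sup>2) + expectation (\<lambda>\<omega>. (norm (dev i t \<omega>))\<^sup>2)"
    using d(1) G(1) sq_integrable_inner[OF G(1) d(1)] by (simp add: sq_integrable_def)
  with d(2) G(2) show "expectation (\<lambda>\<omega>. (norm (g i t \<omega>))\<^sup>2) \<le> V1 + V1'"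
    by simp
qed

lemma res_sq_integrable:
  assumes i: "i \<in> {1..n}" and t: "t < T"
  shows "sq_integrable M (res i t)"
    and "expectation (\<lambda>\<omega>. (norm (res i t \<omega>))\<^sup>2) \<le> (1 - \<delta>2) * (V1 + V1')"
proof -
  note g = g_sq_integrable[OF i t]
  have "(\<lambda>\<omega>. C2 (g i t \<omega>)) \<in> borel_measurable M"
    using measurable_compose[OF g_random_variable[OF i t] C2(2)] .
  then have "res i t \<in> borel_measurable M"
    unfolding res_def[abs_def] using g_random_variable[OF i t] by measurable
  then show sq: "sq_integrable M (res i t)"
    by (rule sq_integrable_norm_le[OF _ g(1)]) (simp add: res_def approx_compressor_norm_le[OF C2(1)])
  have "expectation (\<lambda>\<omega>. (norm (res i t \<omega>))\<^sup>2) \<le> expectation (\<lambda>\<omega>. (1 - \<delta>2) * (norm (g i t \<omega>))\<^sup>2)"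
    using sq g(1) C2(1)
    by (intro integral_mono) (auto simp: sq_integrable_def approx_compressor_def res_def norm_minus_commute)
  also have "\<dots> \<le> (1 - \<delta>2) * (V1 + V1')"
    using g(2) \<delta>_bounds by (simp add: mult_left_mono)
  finally show "expectation (\<lambda>\<omega>. (norm (res i t \<omega>))\<^sup>2) \<le> (1 - \<delta>2) * (V1 + V1')" .
qed

text \<open>The double sum of inner products collapses to its diagonal; the \<open>n\<close>
  remaining terms against the square of \<open>n\<close> give the gain \<open>1 / n\<close>.\<close>

lemma mean_dev_bound:
  assumes t: "t < T"
  shows "sq_integrable M (\<lambda>\<omega>. mean n (\<lambda>i. dev i t \<omega>))"
    and "expectation (\<lambda>\<omega>. (norm (mean n (\<lambda>i. dev i t \<omega>)))\<^sup>2) \<le> V1 / real n"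
proof -
  note d = dev_sq_integrable[OF _ t]
  show "sq_integrable M (\<lambda>\<omega>. mean n (\<lambda>i. dev i t \<omega>))"
    using d by (intro sq_integrable_mean)
  have inner: "expectation (\<lambda>\<omega>. dev i t \<omega> \<bullet> dev j t \<omega>)
      = (if i = j then expectation (\<lambda>\<omega>. (norm (dev i t \<omega>))\<^sup>2) else 0)"
    if i: "i \<in> {1..n}" and j: "j \<in> {1..n}" for i j
  proof (cases "i = j")
    case True
    then show ?thesis
      by (simp add: power2_norm_eq_inner)
  next
    case False
    have "expectation (\<lambda>\<omega>. dev i t \<omega> \<bullet> dev j t \<omega>) = 0"
    \<comment> \<open>The sample of worker \<open>j\<close> is the fresh one; the noise of worker
      \<open>i\<close> depends on the sample of \<open>i\<close> in the same iteration, which the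
      omitted index leaves available.\<close>
    proof (rule dev_orthogonal[OF j t d(1)[OF i]])
      fix N :: "'w measure"
      assume N: "\<And>k s. k \<in> {1..n} \<Longrightarrow> s \<in> {1..T} \<Longrightarrow> (k, s) \<noteq> (j, Suc t) \<Longrightarrow> Z k s \<in> N \<rightarrow>\<^sub>M D k"
      have xi: "x i t \<in> borel_measurable N"
        using i t by (intro run_measurable N) auto
      have "g i t \<in> borel_measurable N"
        using i t False by (intro g_meas xi N) auto
      with measurable_compose[OF xi gF_meas[OF i]] show "dev i t \<in> borel_measurable N"
        unfolding dev_def[abs_def] by measurable
    qed
    with False show ?thesis
      by simp
  qed
  have int: "integrable M (\<lambda>\<omega>. dev i t \<omega> \<bullet> dev j t \<omega>)" if "i \<in> {1..n}" "j \<in> {1..n}" for i j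
    using sq_integrable_inner[OF d(1) d(1)] that .
  have "(norm (\<Sum>i\<in>{1..n}. dev i t \<omega>))\<^sup>2 = (\<Sum>i\<in>{1..n}. \<Sum>j\<in>{1..n}. dev i t \<omega> \<bullet> dev j t \<omega>)" for \<omega>
    unfolding power2_norm_eq_inner inner_sum_left by (simp add: inner_sum_right)
  then have "expectation (\<lambda>\<omega>. (norm (mean n (\<lambda>i. dev i t \<omega>)))\<^sup>2)
      = expectation (\<lambda>\<omega>. \<Sum>i\<in>{1..n}. \<Sum>j\<in>{1..n}. dev i t \<omega> \<bullet> dev j t \<omega>) / (real n)\<^sup>2"
    by (simp add: mean_def power_divide)
  also have "expectation (\<lambda>\<omega>. \<Sum>i\<in>{1..n}. \<Sum>j\<in>{1..n}. dev i t \<omega> \<bullet> dev j t \<omega>)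
      = (\<Sum>i\<in>{1..n}. expectation (\<lambda>\<omega>. \<Sum>j\<in>{1..n}. dev i t \<omega> \<bullet> dev j t \<omega>))"
    by (intro Bochner_Integration.integral_sum Bochner_Integration.integrable_sum int)
  also have "\<dots> = (\<Sum>i\<in>{1..n}. \<Sum>j\<in>{1..n}. expectation (\<lambda>\<omega>. dev i t \<omega> \<bullet> dev j t \<omega>))"
    by (intro sum.cong refl Bochner_Integration.integral_sum int)
  also have "\<dots> = (\<Sum>i\<in>{1..n}. expectation (\<lambda>\<omega>. (norm (dev i t \<omega>))\<^sup>2))"
    by (intro sum.cong refl) (simp add: inner)
  also have "(\<Sum>i\<in>{1..n}. expectation (\<lambda>\<omega>. (norm (dev i t \<omega>))\<^sup>2)) / (real n)\<^sup>2
      \<le> (\<Sum>i\<in>{1..n}. V1) / (real n)\<^sup>2"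
    using d(2) by (intro divide_right_mono sum_mono) auto
  also have "\<dots> = V1 / real n"
    by (simp add: power2_eq_square)
  finally show "expectation (\<lambda>\<omega>. (norm (mean n (\<lambda>i. dev i t \<omega>)))\<^sup>2) \<le> V1 / real n" .
qed

section \<open>Growth and contraction of the local errors\<close>

lemma e_sq_integrable:
  assumes i: "i \<in> {1..n}" and t: "t \<le> T"
  shows "sq_integrable M (e i t)"
  using t
proof (induction t)
  case 0
  then show ?case
    by (simp add: e_0[abs_def] sq_integrable_zero)
next
  case (Suc t)
  then have eh: "sq_integrable M (\<lambda>\<omega>. e i t \<omega> - \<eta> *\<^sub>R res i t \<omega>)"
    using res_sq_integrable(1)[OF i] by (intro sq_integrable_intros) auto
  show ?case
    using run_random_variable(2)[OF i Suc.prems] eh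
    by (rule sq_integrable_norm_le) (simp add: e_Suc approx_compressor_norm_le[OF C1(1)])
qed

text \<open>Compression residuals may be biased, so no orthogonality in time is available.
  Cauchy-Schwarz costs the square of the number of summands, which is the source of
  \<open>H^2\<close>.\<close>

lemma sum_res_bound:
  assumes i: "i \<in> {1..n}" and b: "b \<le> T" "a \<le> b"
  shows "sq_integrable M (\<lambda>\<omega>. \<Sum>s\<in>{a..<b}. res i s \<omega>)"
    and "expectation (\<lambda>\<omega>. (norm (\<Sum>s\<in>{a..<b}. res i s \<omega>))\<^sup>2)
      \<le> (real (b - a))\<^sup>2 * ((1 - \<delta>2) * (V1 + V1'))"
proof -
  have res: "sq_integrable M (res i s)"
    "expectation (\<lambda>\<omega>. (norm (res i s \<omega>))\<^sup>2) \<le> (1 - \<delta>2) * (V1 + V1')" if "s \<in> {a..<b}" for s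
    using res_sq_integrable[OF i, of s] that b by auto
  show sq: "sq_integrable M (\<lambda>\<omega>. \<Sum>s\<in>{a..<b}. res i s \<omega>)"
    using res by (intro sq_integrable_intros)
  have int: "integrable M (\<lambda>\<omega>. (norm (res i s \<omega>))\<^sup>2)" if "s \<in> {a..<b}" for s
    using res[OF that] by (simp add: sq_integrable_def)
  have "expectation (\<lambda>\<omega>. (norm (\<Sum>s\<in>{a..<b}. res i s \<omega>))\<^sup>2)
      \<le> expectation (\<lambda>\<omega>. real (b - a) * (\<Sum>s\<in>{a..<b}. (norm (res i s \<omega>))\<^sup>2))"
  proof (rule integral_mono)
    show "integrable M (\<lambda>\<omega>. (norm (\<Sum>s\<in>{a..<b}. res i s \<omega>))\<^sup>2)"
      using sq by (simp add: sq_integrable_def)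
    show "integrable M (\<lambda>\<omega>. real (b - a) * (\<Sum>s\<in>{a..<b}. (norm (res i s \<omega>))\<^sup>2))"
      using int by (intro integrable_mult_right Bochner_Integration.integrable_sum)
    show "(norm (\<Sum>s\<in>{a..<b}. res i s \<omega>))\<^sup>2 \<le> real (b - a) * (\<Sum>s\<in>{a..<b}. (norm (res i s \<omega>))\<^sup>2)" for \<omega>
      using norm_sum_power2_le[of "\<lambda>s. res i s \<omega>" "{a..<b}"] by simp
  qed
  also have "\<dots> = real (b - a) * (\<Sum>s\<in>{a..<b}. expectation (\<lambda>\<omega>. (norm (res i s \<omega>))\<^sup>2))"
    using int by (simp add: Bochner_Integration.integral_sum)
  also have "\<dots> \<le> real (b - a) * (\<Sum>s\<in>{a..<b}. (1 - \<delta>2) * (V1 + V1'))"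
    using res(2) by (intro mult_left_mono sum_mono) auto
  also have "\<dots> = (real (b - a))\<^sup>2 * ((1 - \<delta>2) * (V1 + V1'))"
    by (simp add: power2_eq_square)
  finally show "expectation (\<lambda>\<omega>. (norm (\<Sum>s\<in>{a..<b}. res i s \<omega>))\<^sup>2)
      \<le> (real (b - a))\<^sup>2 * ((1 - \<delta>2) * (V1 + V1'))" .
qed

lemma e_between_resets:
  assumes "k < H"
  shows "e i (m * H + k) \<omega> = e i (m * H) \<omega> - \<eta> *\<^sub>R (\<Sum>s\<in>{m * H..<m * H + k}. res i s \<omega>)"
  using assms
proof (induction k)
  case (Suc k)
  have "\<not> H dvd Suc k"
    using Suc.prems by (simp add: nat_dvd_not_less)
  then have "\<not> H dvd m * H + Suc k"
    using dvd_add_right_iff[of H "m * H" "Suc k"] by auto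
  then have "\<not> H dvd Suc (m * H + k)"
    by simp
  then show ?case
    using Suc by (simp add: e_Suc scaleR_add_right)
qed simp

lemma e_reset:
  "(norm (e i (Suc m * H) \<omega>))\<^sup>2 \<le> (1 - \<delta>1 / 2) * (norm (e i (m * H) \<omega>))\<^sup>2
    + (1 - \<delta>1) * (2 - \<delta>1) / \<delta>1 * (\<eta>\<^sup>2 * (norm (\<Sum>s\<in>{m * H..<m * H + H}. res i s \<omega>))\<^sup>2)"
proof -
  \<comment> \<open>\<open>e_between_resets\<close> reaches only the state before the reset
    iteration; the residual of that iteration is added before \<open>C1\<close> is applied, which
    completes the sum over all \<open>H\<close> steps.\<close>
  obtain h where h: "H = Suc h"
    using H by (cases H) auto
  define S where "S = (\<Sum>s\<in>{m * H..<m * H + H}. res i s \<omega>)"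
  have S: "S = (\<Sum>s\<in>{m * H..<m * H + h}. res i s \<omega>) + res i (m * H + h) \<omega>"
    unfolding S_def by (simp add: h)
  have t: "Suc m * H = Suc (m * H + h)"
    using h by simp
  have "e i (m * H + h) \<omega> - \<eta> *\<^sub>R res i (m * H + h) \<omega> = e i (m * H) \<omega> + (- \<eta>) *\<^sub>R S"
    unfolding S by (subst e_between_resets) (auto simp: h algebra_simps)
  moreover have "H dvd Suc (m * H + h)"
    unfolding t[symmetric] by (rule dvd_triv_right)
  ultimately have "e i (Suc m * H) \<omega> = e i (m * H) \<omega> + (- \<eta>) *\<^sub>R S - C1 (e i (m * H) \<omega> + (- \<eta>) *\<^sub>R S)"
    unfolding t e_Suc by simp
  then have "(norm (e i (Suc m * H) \<omega>))\<^sup>2 \<le> (1 - \<delta>1) * (norm (e i (m * H) \<omega> + (- \<eta>) *\<^sub>R S))\<^sup>2"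
    using C1(1) unfolding approx_compressor_def by (metis norm_minus_commute)
  also have "\<dots> \<le> (1 - \<delta>1 / 2) * (norm (e i (m * H) \<omega>))\<^sup>2
      + (1 - \<delta>1) * (2 - \<delta>1) / \<delta>1 * (norm ((- \<eta>) *\<^sub>R S))\<^sup>2"
    using \<delta>1 \<delta>_bounds(1) by (rule weighted_young)
  finally show ?thesis
    by (simp add: S_def power_mult_distrib)
qed

text \<open>The sign is read off from an actual gradient, the first one of worker 1, which exists
  once there is an iteration.\<close>

lemma second_moment_nonneg:
  assumes "0 < T"
  shows "0 \<le> V1 + V1'"
proof -
  have "0 \<le> expectation (\<lambda>\<omega>. (norm (g 1 0 \<omega>))\<^sup>2)"
    by simp
  also have "\<dots> \<le> V1 + V1'"
    using n assms by (intro g_sq_integrable) auto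
  finally show ?thesis .
qed

text \<open>\<open>?K * ?B\<close> is a supersolution of the recursion in \<open>e_reset\<close>:
  its fixed point is \<open>2 / \<delta>1\<close> times the coefficient \<open>?c\<close> of
  \<open>?B\<close>, and \<open>?c\<close> is at most
  \<open>2 * (1 - \<delta>1) / \<delta>1\<close>.\<close>

lemma e_bound_at_reset:
  assumes i: "i \<in> {1..n}" and T: "0 < T" and m: "m * H \<le> T"
  shows "expectation (\<lambda>\<omega>. (norm (e i (m * H) \<omega>))\<^sup>2)
    \<le> 4 * (1 - \<delta>1) / \<delta>1\<^sup>2 * (\<eta>\<^sup>2 * ((real H)\<^sup>2 * ((1 - \<delta>2) * (V1 + V1'))))"
    (is "_ \<le> ?K * ?B")
  using m
proof (induction m)
  case 0
  have "0 \<le> ?K * ?B"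
    using second_moment_nonneg[OF T] \<delta>_bounds by (intro mult_nonneg_nonneg divide_nonneg_nonneg) auto
  then show ?case
    by (simp add: e_0)
next
  case (Suc m)
  have m: "m * H \<le> T" and mH: "m * H + H \<le> T"
    using Suc.prems by auto
  let ?S = "\<lambda>\<omega>. \<Sum>s\<in>{m * H..<m * H + H}. res i s \<omega>"
  note S = sum_res_bound[OF i mH, of "m * H"]
  let ?c = "(1 - \<delta>1) * (2 - \<delta>1) / \<delta>1"
  have c: "0 \<le> ?c" "0 \<le> 1 - \<delta>1 / 2"
    using \<delta>1 \<delta>_bounds by auto
  have B: "0 \<le> ?B"
    using second_moment_nonneg[OF T] \<delta>_bounds by simp
  have "expectation (\<lambda>\<omega>. (norm (e i (Suc m * H) \<omega>))\<^sup>2)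
      \<le> expectation (\<lambda>\<omega>. (1 - \<delta>1 / 2) * (norm (e i (m * H) \<omega>))\<^sup>2 + ?c * (\<eta>\<^sup>2 * (norm (?S \<omega>))\<^sup>2))"
    using e_sq_integrable[OF i Suc.prems] e_sq_integrable[OF i m] S(1) e_reset
    by (intro integral_mono) (auto simp: sq_integrable_def)
  also have "\<dots> = (1 - \<delta>1 / 2) * expectation (\<lambda>\<omega>. (norm (e i (m * H) \<omega>))\<^sup>2)
      + ?c * (\<eta>\<^sup>2 * expectation (\<lambda>\<omega>. (norm (?S \<omega>))\<^sup>2))"
    using e_sq_integrable[OF i m] S(1) by (simp add: sq_integrable_def)
  also have "\<dots> \<le> (1 - \<delta>1 / 2) * (?K * ?B) + ?c * ?B"
    using Suc.IH[OF m] S(2) c by (intro add_mono mult_left_mono) auto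
  also have "\<dots> \<le> (1 - \<delta>1 / 2) * (?K * ?B) + \<delta>1 / 2 * ?K * ?B"
  proof -
    have "?c \<le> (1 - \<delta>1) * 2 / \<delta>1"
      using \<delta>1 \<delta>_bounds by (intro divide_right_mono mult_left_mono) auto
    also have "\<dots> = \<delta>1 / 2 * ?K"
      using \<delta>1 by (simp add: field_simps power2_eq_square)
    finally show ?thesis
      using B by (intro add_left_mono mult_right_mono)
  qed
  also have "\<dots> = ?K * ?B"
  proof -
    \<comment> \<open>Stated for plain variables so that simplification does not expand
      \<open>?K\<close> and \<open>?B\<close>.\<close>
    have "(1 - q / 2) * (a * b) + q / 2 * a * b = a * b" for q a b :: real
      by (simp add: field_simps)
    then show ?thesis .
  qed
  finally show ?case .
qed

text \<open>Splitting \<open>t\<close> at the last reset leaves fewer than \<open>H\<close> further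
  residuals. They contribute the summand 1 beside the reset constant, and separating the two parts
  costs the leading factor 2.\<close>

lemma e_bound:
  assumes i: "i \<in> {1..n}" and T: "0 < T" and t: "t \<le> T"
  shows "expectation (\<lambda>\<omega>. (norm (e i t \<omega>))\<^sup>2)
    \<le> 2 * (4 * (1 - \<delta>1) / \<delta>1\<^sup>2 + 1) * (\<eta>\<^sup>2 * ((real H)\<^sup>2 * ((1 - \<delta>2) * (V1 + V1'))))"
    (is "_ \<le> 2 * (?K + 1) * (\<eta>\<^sup>2 * ((real H)\<^sup>2 * ?s))")
proof -
  define m k where "m = t div H" and "k = t mod H"
  have tk: "t = m * H + k" and k: "k < H"
    using H by (simp_all add: m_def k_def)
  have m: "m * H \<le> T" and mk: "m * H + k \<le> T"
    using t tk by auto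
  have s: "0 \<le> ?s"
    using second_moment_nonneg[OF T] \<delta>_bounds by simp
  let ?S = "\<lambda>\<omega>. \<Sum>s\<in>{m * H..<m * H + k}. res i s \<omega>"
  note S = sum_res_bound[OF i mk, of "m * H"]
  have "expectation (\<lambda>\<omega>. (norm (e i t \<omega>))\<^sup>2)
      \<le> expectation (\<lambda>\<omega>. 2 * (norm (e i (m * H) \<omega>))\<^sup>2 + 2 * (\<eta>\<^sup>2 * (norm (?S \<omega>))\<^sup>2))"
  proof (rule integral_mono)
    show "integrable M (\<lambda>\<omega>. (norm (e i t \<omega>))\<^sup>2)"
      "integrable M (\<lambda>\<omega>. 2 * (norm (e i (m * H) \<omega>))\<^sup>2 + 2 * (\<eta>\<^sup>2 * (norm (?S \<omega>))\<^sup>2))"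
      using e_sq_integrable[OF i t] e_sq_integrable[OF i m] S(1) by (auto simp: sq_integrable_def)
    show "(norm (e i t \<omega>))\<^sup>2 \<le> 2 * (norm (e i (m * H) \<omega>))\<^sup>2 + 2 * (\<eta>\<^sup>2 * (norm (?S \<omega>))\<^sup>2)" for \<omega>
      using norm_add_power2_le[of "e i (m * H) \<omega>" "(- \<eta>) *\<^sub>R ?S \<omega>"]
      unfolding tk e_between_resets[OF k] by (simp add: power_mult_distrib)
  qed
  also have "\<dots> = 2 * expectation (\<lambda>\<omega>. (norm (e i (m * H) \<omega>))\<^sup>2)
      + 2 * (\<eta>\<^sup>2 * expectation (\<lambda>\<omega>. (norm (?S \<omega>))\<^sup>2))"
    using e_sq_integrable[OF i m] S(1) by (simp add: sq_integrable_def)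
  also have "\<dots> \<le> 2 * (?K * (\<eta>\<^sup>2 * ((real H)\<^sup>2 * ?s))) + 2 * (\<eta>\<^sup>2 * ((real k)\<^sup>2 * ?s))"
    using e_bound_at_reset[OF i T m] S(2) by (intro add_mono mult_left_mono) auto
  also have "\<dots> \<le> 2 * (?K * (\<eta>\<^sup>2 * ((real H)\<^sup>2 * ?s))) + 2 * (\<eta>\<^sup>2 * ((real H)\<^sup>2 * ?s))"
    using k s by (intro add_left_mono mult_left_mono mult_right_mono power_mono) auto
  also have "\<dots> = 2 * (?K + 1) * (\<eta>\<^sup>2 * ((real H)\<^sup>2 * ?s))"
    by (simp add: algebra_simps)
  finally show ?thesis .
qed

section \<open>The gradient along the mean iterate\<close>

text \<open>The gradient assumption concerns the models of the workers, not the mean iterate.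
  Integrability is carried over by the pathwise deviation bound, whose right side is integrable
  because the errors are.\<close>

lemma nabla_F_sq_integrable:
  assumes t: "t < T"
  shows "sq_integrable M (\<lambda>\<omega>. nabla F (xbar t \<omega>))"
proof -
  let ?v = "\<lambda>\<omega>. nabla F (xbar t \<omega>) - mean n (\<lambda>i. gF i (x i t \<omega>))"
  have b: "sq_integrable M (\<lambda>\<omega>. mean n (\<lambda>i. gF i (x i t \<omega>)))"
    using gF_sq_integrable(1)[OF _ t] by (intro sq_integrable_mean)
  have "xbar t \<in> borel_measurable M"
    unfolding xbar_mean[abs_def] using run_random_variable(1) t by (intro borel_measurable_mean) auto
  from measurable_compose[OF this L_smooth_nabla_measurable[OF L_smooth_F]]
  have "?v \<in> borel_measurable M"
    using b by (intro borel_measurable_diff) (auto simp: sq_integrable_def)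
  then have "sq_integrable M ?v"
  proof (rule sq_integrable_AE_bound)
    show "integrable M (\<lambda>\<omega>. L\<^sup>2 * ((\<Sum>i\<in>{1..n}. (norm (e i t \<omega>))\<^sup>2) / real n))"
      using e_sq_integrable t
      by (intro integrable_mult_right integrable_divide Bochner_Integration.integrable_sum)
         (auto simp: sq_integrable_def)
  qed (use nabla_F_deviation in blast)
  from sq_integrable_add[OF this b] show ?thesis
    by simp
qed

lemma sum_gradient_bound:
  assumes T: "0 < T" and min: "\<And>y. F xstar \<le> F y"
  shows "\<eta> / 2 * (\<Sum>t<T. expectation (\<lambda>\<omega>. (norm (nabla F (xbar t \<omega>)))\<^sup>2)) \<le> F x0 - F xstar
    + real T * (\<eta> / 2 * (L\<^sup>2 * (2 * (4 * (1 - \<delta>1) / \<delta>1\<^sup>2 + 1) * (\<eta>\<^sup>2 * ((real H)\<^sup>2 * ((1 - \<delta>2) * (V1 + V1'))))))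
      + L * \<eta>\<^sup>2 / 2 * (V1 / real n))"
    (is "_ \<le> _ + real T * (\<eta> / 2 * (L\<^sup>2 * ?E) + _)")
proof -
  \<comment> \<open>The terms of \<open>descent\<close> by role: \<open>a\<close> the gradient to be
    bounded, \<open>b\<close> the local errors, \<open>d\<close> the noise variance,
    \<open>c\<close> the linear noise term with coefficient \<open>\<phi>\<close>.\<close>
  define a where "a t \<omega> = (norm (nabla F (xbar t \<omega>)))\<^sup>2" for t \<omega>
  define b where "b t \<omega> = \<eta> / 2 * (L\<^sup>2 * ((\<Sum>i\<in>{1..n}. (norm (e i t \<omega>))\<^sup>2) / real n))" for t \<omega>
  define d where "d t \<omega> = L * \<eta>\<^sup>2 / 2 * (norm (mean n (\<lambda>i. dev i t \<omega>)))\<^sup>2" for t \<omega>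
  define \<phi> where "\<phi> t \<omega> = (L * \<eta>\<^sup>2) *\<^sub>R mean n (\<lambda>i. gF i (x i t \<omega>)) - \<eta> *\<^sub>R nabla F (xbar t \<omega>)" for t \<omega>
  define c where "c t \<omega> = \<phi> t \<omega> \<bullet> mean n (\<lambda>i. dev i t \<omega>)" for t \<omega>
  have path: "\<eta> / 2 * (\<Sum>t<k. a t \<omega>) \<le> F x0 - F (xbar k \<omega>) + (\<Sum>t<k. b t \<omega> + d t \<omega> + c t \<omega>)" for k \<omega>
  proof (induction k)
    case (Suc k)
    then show ?case
      using descent[of k \<omega>] unfolding a_def b_def d_def c_def \<phi>_def
      by (simp only: sum.lessThan_Suc distrib_left)
  qed (simp add: xbar_0)
  have \<phi>: "sq_integrable M (\<phi> t)" if "t < T" for t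
    unfolding \<phi>_def[abs_def] using that nabla_F_sq_integrable gF_sq_integrable(1)
    by (intro sq_integrable_intros sq_integrable_mean)
  have a: "integrable M (a t)" if "t < T" for t
    using nabla_F_sq_integrable[OF that] by (simp add: a_def[abs_def] sq_integrable_def)
  have b: "integrable M (b t)" "expectation (b t) \<le> \<eta> / 2 * (L\<^sup>2 * ?E)" if t: "t < T" for t
  proof -
    have int: "integrable M (\<lambda>\<omega>. (norm (e i t \<omega>))\<^sup>2)" if "i \<in> {1..n}" for i
      using e_sq_integrable[OF that, of t] t by (simp add: sq_integrable_def)
    then show "integrable M (b t)"
      unfolding b_def[abs_def] by (intro integrable_mult_right integrable_divide Bochner_Integration.integrable_sum)
    have "expectation (b t) = \<eta> / 2 * (L\<^sup>2 * ((\<Sum>i\<in>{1..n}. expectation (\<lambda>\<omega>. (norm (e i t \<omega>))\<^sup>2)) / real n))"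
      unfolding b_def[abs_def] using int by (simp add: Bochner_Integration.integral_sum)
    also have "\<dots> \<le> \<eta> / 2 * (L\<^sup>2 * ((\<Sum>i\<in>{1..n}. ?E) / real n))"
      using e_bound[OF _ T, of _ t] t \<eta> by (intro mult_left_mono divide_right_mono sum_mono) auto
    also have "\<dots> = \<eta> / 2 * (L\<^sup>2 * ?E)"
      using n by simp
    finally show "expectation (b t) \<le> \<eta> / 2 * (L\<^sup>2 * ?E)" .
  qed
  have d: "integrable M (d t)" "expectation (d t) \<le> L * \<eta>\<^sup>2 / 2 * (V1 / real n)" if t: "t < T" for t
  proof -
    show "integrable M (d t)"
      using mean_dev_bound(1)[OF t] by (auto simp: d_def[abs_def] sq_integrable_def)
    have "expectation (d t) = L * \<eta>\<^sup>2 / 2 * expectation (\<lambda>\<omega>. (norm (mean n (\<lambda>i. dev i t \<omega>)))\<^sup>2)"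
      by (simp add: d_def[abs_def])
    also have "\<dots> \<le> L * \<eta>\<^sup>2 / 2 * (V1 / real n)"
      using mean_dev_bound(2)[OF t] L by (intro mult_left_mono) auto
    finally show "expectation (d t) \<le> L * \<eta>\<^sup>2 / 2 * (V1 / real n)" .
  qed
  have c: "integrable M (c t)" "expectation (c t) = 0" if t: "t < T" for t
  proof -
    show "integrable M (c t)"
      unfolding c_def[abs_def] using \<phi>[OF t] mean_dev_bound(1)[OF t] by (rule sq_integrable_inner)
    have orth: "expectation (\<lambda>\<omega>. \<phi> t \<omega> \<bullet> dev i t \<omega>) = 0" if i: "i \<in> {1..n}" for i
    proof (rule dev_orthogonal[OF i t \<phi>[OF t]])
      fix N :: "'w measure"
      assume N: "\<And>j s. j \<in> {1..n} \<Longrightarrow> s \<in> {1..T} \<Longrightarrow> (j, s) \<noteq> (i, Suc t) \<Longrightarrow> Z j s \<in> N \<rightarrow>\<^sub>M D j"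
      have x: "x j t \<in> borel_measurable N" if "j \<in> {1..n}" for j
        using t that by (intro run_measurable N) auto
      then have "xbar t \<in> borel_measurable N"
        unfolding xbar_mean[abs_def] by (intro borel_measurable_mean)
      from measurable_compose[OF this L_smooth_nabla_measurable[OF L_smooth_F]]
      have "(\<lambda>\<omega>. nabla F (xbar t \<omega>)) \<in> borel_measurable N" .
      moreover have "(\<lambda>\<omega>. mean n (\<lambda>i. gF i (x i t \<omega>))) \<in> borel_measurable N"
        using measurable_compose[OF x gF_meas] by (intro borel_measurable_mean)
      ultimately show "\<phi> t \<in> borel_measurable N"
        unfolding \<phi>_def[abs_def] by measurable
    qed
    have c: "c t = (\<lambda>\<omega>. (\<Sum>i\<in>{1..n}. \<phi> t \<omega> \<bullet> dev i t \<omega>) / real n)"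
      by (simp add: fun_eq_iff c_def mean_def inner_sum_right)
    have "expectation (c t) = (\<Sum>i\<in>{1..n}. expectation (\<lambda>\<omega>. \<phi> t \<omega> \<bullet> dev i t \<omega>)) / real n"
      unfolding c using sq_integrable_inner[OF \<phi>[OF t] dev_sq_integrable(1)[OF _ t]]
      by (simp add: Bochner_Integration.integral_sum)
    then show "expectation (c t) = 0"
      by (simp add: orth)
  qed
  have "\<eta> / 2 * (\<Sum>t<T. expectation (a t)) = expectation (\<lambda>\<omega>. \<eta> / 2 * (\<Sum>t<T. a t \<omega>))"
    using a by (simp add: Bochner_Integration.integral_sum)
  also have "\<dots> \<le> expectation (\<lambda>\<omega>. (F x0 - F xstar) + (\<Sum>t<T. b t \<omega> + d t \<omega> + c t \<omega>))"
  proof (rule integral_mono)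
    show "integrable M (\<lambda>\<omega>. \<eta> / 2 * (\<Sum>t<T. a t \<omega>))"
      using a by (intro integrable_mult_right Bochner_Integration.integrable_sum) auto
    show "integrable M (\<lambda>\<omega>. (F x0 - F xstar) + (\<Sum>t<T. b t \<omega> + d t \<omega> + c t \<omega>))"
      using b c d by (intro Bochner_Integration.integrable_add Bochner_Integration.integrable_sum) auto
    \<comment> \<open>The last value of \<open>F\<close> is replaced by the minimum on each path, so
      no random value of \<open>F\<close> remains under the integral.\<close>
    show "\<eta> / 2 * (\<Sum>t<T. a t \<omega>) \<le> (F x0 - F xstar) + (\<Sum>t<T. b t \<omega> + d t \<omega> + c t \<omega>)" for \<omega>
      by (rule order_trans[OF path]) (simp add: min)
  qed
  also have "\<dots> = (F x0 - F xstar) + expectation (\<lambda>\<omega>. \<Sum>t<T. b t \<omega> + d t \<omega> + c t \<omega>)"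
    using b(1) c(1) d(1) by (subst Bochner_Integration.integral_add) (auto simp: prob_space)
  also have "expectation (\<lambda>\<omega>. \<Sum>t<T. b t \<omega> + d t \<omega> + c t \<omega>)
      = (\<Sum>t<T. expectation (\<lambda>\<omega>. b t \<omega> + d t \<omega> + c t \<omega>))"
    using b(1) c(1) d(1) by (intro Bochner_Integration.integral_sum) auto
  also have "\<dots> = (\<Sum>t<T. expectation (b t) + expectation (d t) + expectation (c t))"
    by (intro sum.cong refl) (simp add: b(1) c(1) d(1))
  also have "F x0 - F xstar + (\<Sum>t<T. expectation (b t) + expectation (d t) + expectation (c t))
      \<le> (F x0 - F xstar) + (\<Sum>t<T. \<eta> / 2 * (L\<^sup>2 * ?E) + L * \<eta>\<^sup>2 / 2 * (V1 / real n))"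
    using b(2) c(2) d(2) by (intro add_left_mono sum_mono) (simp add: add_mono)
  also have "\<dots> = (F x0 - F xstar) + real T * (\<eta> / 2 * (L\<^sup>2 * ?E) + L * \<eta>\<^sup>2 / 2 * (V1 / real n))"
    by simp
  finally show ?thesis
    by (simp add: a_def)
qed

end

subsection \<open>The step size\<close>

text \<open>The cube is exactly the constant that multiplies \<open>\<eta>^2 * (V1 + V1')\<close> in
  \<open>e_bound\<close>.\<close>

lemma cser_factor_cubed:
  assumes "0 < \<delta>1" "\<delta>1 \<le> 1" "\<delta>2 \<le> 1"
  shows "cser_factor \<delta>1 \<delta>2 H ^ 3 = 2 * (4 * (1 - \<delta>1) / \<delta>1\<^sup>2 + 1) * ((real H)\<^sup>2 * (1 - \<delta>2))"
proof -
  \<comment> \<open>Base 0 is treated apart, as it occurs for \<open>\<delta>2 = 1\<close>.\<close>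
  have cube: "(a powr (1/3)) ^ 3 = a" if "0 \<le> a" for a :: real
    using that by (cases "a = 0") (simp_all add: powr_powr flip: powr_numeral)
  have "(real H powr (2/3)) ^ 3 = (real H)\<^sup>2"
    by (cases "H = 0") (simp_all add: powr_powr flip: powr_numeral)
  moreover have "0 \<le> 4 * (1 - \<delta>1) / \<delta>1\<^sup>2 + 1"
    using assms by simp
  ultimately show ?thesis
    unfolding cser_factor_def power_mult_distrib using assms by (simp add: cube)
qed

lemma cser_factor_nonneg: "0 \<le> cser_factor \<delta>1 \<delta>2 H"
  by (simp add: cser_factor_def)

text \<open>The threshold \<open>(\<gamma> * L)\<^sup>2\<close> for \<open>T / n\<close> makes the first argument of the minimum in
  \<open>cser_stepsize\<close> the smaller one.\<close>

lemma cser_stepsize_eq: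
  assumes "0 < \<gamma>" "0 < L" "1 \<le> n" "(\<gamma> * L)\<^sup>2 * real n \<le> real T"
  shows "cser_stepsize \<delta>1 \<delta>2 H L \<gamma> n T
    = \<gamma> / (sqrt (real T / real n) + cser_factor \<delta>1 \<delta>2 H * real T powr (1/3))"
proof -
  have "\<gamma> * L \<le> sqrt (real T / real n)"
    using assms by (intro real_le_rsqrt) (simp add: field_simps)
  also have "\<dots> \<le> sqrt (real T / real n) + cser_factor \<delta>1 \<delta>2 H * real T powr (1/3)" (is "_ \<le> ?q")
    by (simp add: cser_factor_nonneg)
  finally have "\<gamma> * L \<le> ?q" .
  moreover from this have "0 < ?q"
    using assms by (meson less_le_trans mult_pos_pos)
  ultimately have "\<gamma> / ?q \<le> 1 / L"
    using assms by (simp add: field_simps)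
  then show ?thesis
    unfolding cser_stepsize_def by simp
qed

text \<open>With \<open>q\<close> the square root of \<open>TT / nn\<close> and \<open>r\<close> the
  cube root of \<open>TT\<close>, each summand of the denominator of \<open>\<eta>\<close> controls
  one term: \<open>\<eta> * q \<le> \<gamma>\<close> the variance,
  \<open>\<eta> * (B * r) \<le> \<gamma>\<close> the errors. The initial gap is divided by
  \<open>\<eta> * TT\<close>, whose reciprocal splits exactly into the two rates.\<close>

lemma stepsize_bound:
  fixes \<eta> \<gamma> L V1 V2 B G :: real
  assumes pos: "0 < \<gamma>" "0 < L" "0 < nn" "0 < TT" "0 \<le> B" "0 \<le> V1" "0 \<le> V2"
    and \<eta>: "\<eta> = \<gamma> / (sqrt (TT / nn) + B * TT powr (1/3))"
    and S: "\<eta> / 2 * S \<le> G + TT * (\<eta> / 2 * (L\<^sup>2 * (B ^ 3 * \<eta>\<^sup>2 * V2)) + L * \<eta>\<^sup>2 / 2 * (V1 / nn))"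
  shows "1 / TT * S \<le> 1 / sqrt (nn * TT) * (2 * G / \<gamma> + \<gamma> * L * V1)
     + B / TT powr (2/3) * (2 * G / \<gamma> + \<gamma>\<^sup>2 * L\<^sup>2 * V2)"
proof -
  define q r where "q = sqrt (TT / nn)" and "r = TT powr (1/3)"
  have q: "0 < q" and r: "0 < r"
    using pos by (simp_all add: q_def r_def)
  have r3: "r ^ 3 = TT"
    using pos by (simp add: r_def powr_powr flip: powr_numeral)
  have r2: "TT powr (2/3) = r\<^sup>2"
    using pos by (simp add: r_def powr_powr flip: powr_numeral)
  have q2: "q\<^sup>2 * nn = TT"
    using pos by (simp add: q_def)
  have nT: "sqrt (nn * TT) = nn * q"
    using q pos by (intro real_sqrt_unique) (auto simp: power_mult_distrib power2_eq_square simp flip: q2)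
  have den: "0 < q + B * r"
    using q r pos by (simp add: add_pos_nonneg)
  have \<eta>': "\<eta> = \<gamma> / (q + B * r)"
    unfolding \<eta> q_def r_def ..
  have \<eta>0: "0 < \<eta>"
    unfolding \<eta>' using den pos by simp
  have \<eta>q: "\<eta> * q \<le> \<gamma>" and \<eta>r: "\<eta> * (B * r) \<le> \<gamma>"
    using den q r pos unfolding \<eta>' by (simp_all add: field_simps)
  have "\<eta> / 2 * (1 / TT * S) = (\<eta> / 2 * S) / TT"
    by simp
  also have "\<dots> \<le> (G + TT * (\<eta> / 2 * (L\<^sup>2 * (B ^ 3 * \<eta>\<^sup>2 * V2)) + L * \<eta>\<^sup>2 / 2 * (V1 / nn))) / TT"
    using S pos by (intro divide_right_mono) auto
  also have "\<dots> = \<eta> / 2 * (2 * G / (\<eta> * TT) + L\<^sup>2 * (B ^ 3 * \<eta>\<^sup>2 * V2) + L * \<eta> * V1 / nn)"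
    using \<eta>0 pos by (simp add: field_simps power2_eq_square)
  finally have "1 / TT * S \<le> 2 * G / (\<eta> * TT) + L\<^sup>2 * (B ^ 3 * \<eta>\<^sup>2 * V2) + L * \<eta> * V1 / nn"
    by (rule mult_left_le_imp_le) (use \<eta>0 in simp)
  also have "\<dots> \<le> 2 * G / (\<eta> * TT) + L\<^sup>2 * (B / r\<^sup>2 * \<gamma>\<^sup>2 * V2) + L * (\<gamma> / q) * V1 / nn"
  proof (intro add_mono mult_left_mono divide_right_mono mult_right_mono order_refl)
    have "(\<eta> * (B * r))\<^sup>2 \<le> \<gamma>\<^sup>2"
      using \<eta>r \<eta>0 pos r by (intro power_mono) auto
    \<comment> \<open>Two of the three factors \<open>B\<close> are absorbed together with
      \<open>\<eta>\<close> and \<open>r\<close>; the third survives in the rate.\<close>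
    then have "B * (\<eta> * (B * r))\<^sup>2 / r\<^sup>2 \<le> B * \<gamma>\<^sup>2 / r\<^sup>2"
      using pos by (intro divide_right_mono mult_left_mono) auto
    moreover have "B * (\<eta> * (B * r))\<^sup>2 / r\<^sup>2 = B ^ 3 * \<eta>\<^sup>2"
      using r by (simp add: power_mult_distrib power2_eq_square power3_eq_cube)
    ultimately show "B ^ 3 * \<eta>\<^sup>2 \<le> B / r\<^sup>2 * \<gamma>\<^sup>2"
      by simp
    show "\<eta> \<le> \<gamma> / q"
      using \<eta>q q by (simp add: field_simps)
  qed (use pos \<eta>0 in auto)
  also have "\<dots> = 1 / (nn * q) * (2 * G / \<gamma> + \<gamma> * L * V1) + B / r\<^sup>2 * (2 * G / \<gamma> + \<gamma>\<^sup>2 * L\<^sup>2 * V2)"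
  proof -
    have "2 * G / (\<eta> * TT) = 2 * G / \<gamma> * ((q + B * r) / TT)"
      unfolding \<eta>' using den pos by (simp add: field_simps)
    also have "(q + B * r) / TT = 1 / (nn * q) + B / r\<^sup>2"
    proof -
      have "q / TT = 1 / (nn * q)"
        unfolding q2[symmetric] using q pos by (simp add: power2_eq_square)
      moreover have "B * r / TT = B / r\<^sup>2"
        unfolding r3[symmetric] using r by (simp add: power2_eq_square power3_eq_cube)
      ultimately show ?thesis
        by (simp add: add_divide_distrib)
    qed
    finally show ?thesis
      using pos q r by (simp add: distrib_left mult.commute mult.left_commute)
  qed
  finally show ?thesis
    unfolding nT r2 .
qed

text \<open>Relative to the leading rate the second term decays like T to the power -1/6, that is
  1/2 - 2/3. Any strict margin in \<open>K\<close> absorbs it; \<open>n\<close> affects only how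
  large \<open>T\<close> has to be.\<close>

lemma cser_bound_eventually_le:
  assumes "1 \<le> n" and K: "Fo / \<gamma> + \<gamma> * L * V1 < K"
  shows "\<forall>\<^sub>F T in sequentially. cser_bound \<delta>1 \<delta>2 H L V1 V2 \<gamma> Fo n T \<le> K / sqrt (real n * real T)"
proof -
  define p c where "p = Fo / \<gamma> + \<gamma> * L * V1"
    and "c = cser_factor \<delta>1 \<delta>2 H * (Fo / \<gamma> + \<gamma>\<^sup>2 * L\<^sup>2 * V2) * sqrt (real n)"
  have "(\<lambda>T. c * real T powr (-1/6)) \<longlonglongrightarrow> c * 0"
    by (intro tendsto_mult tendsto_const tendsto_neg_powr filterlim_real_sequentially) simp
  then have "\<forall>\<^sub>F T in sequentially. c * real T powr (-1/6) < K - p"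
    using K by (intro order_tendstoD(2)) (auto simp: p_def)
  with eventually_gt_at_top[of 0] show ?thesis
  proof eventually_elim
    case (elim T)
    have s: "0 < sqrt (real n * real T)"
      using assms(1) elim(1) by simp
    have "real T powr (-1/6) = real T powr (1/2) / real T powr (2/3)"
      by (simp flip: powr_diff)
    then have "c * real T powr (-1/6)
        = cser_factor \<delta>1 \<delta>2 H / real T powr (2/3) * (Fo / \<gamma> + \<gamma>\<^sup>2 * L\<^sup>2 * V2) * sqrt (real n * real T)"
      by (simp add: c_def real_sqrt_mult powr_half_sqrt)
    with elim(2) have "p + cser_factor \<delta>1 \<delta>2 H / real T powr (2/3) * (Fo / \<gamma> + \<gamma>\<^sup>2 * L\<^sup>2 * V2) * sqrt (real n * real T) \<le> K"
      by simp
    moreover have "cser_bound \<delta>1 \<delta>2 H L V1 V2 \<gamma> Fo n T * sqrt (real n * real T)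
        = p + cser_factor \<delta>1 \<delta>2 H / real T powr (2/3) * (Fo / \<gamma> + \<gamma>\<^sup>2 * L\<^sup>2 * V2) * sqrt (real n * real T)"
    proof -
      have "1 / r * a * r = a" if "0 < r" for r a :: real
        using that by simp
      from this[OF s] show ?thesis
        unfolding cser_bound_def p_def distrib_right[of "1 / sqrt (real n * real T) * _"] by simp
    qed
    ultimately show ?case
      using s by (simp add: pos_le_divide_eq)
  qed
qed

section \<open>Combination of the estimates\<close>

lemma cser_run_bound:
  fixes C1 C2 :: "'a::euclidean_space \<Rightarrow> 'a" and D :: "nat \<Rightarrow> 'z measure"
    and f :: "'a \<Rightarrow> 'z \<Rightarrow> real" and M :: "'w measure" and Z :: "nat \<Rightarrow> nat \<Rightarrow> 'w \<Rightarrow> 'z"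
    and x0 xstar :: 'a and \<delta>1 \<delta>2 L V1 V1' \<gamma> :: real and n T H :: nat
  defines "\<eta> \<equiv> cser_stepsize \<delta>1 \<delta>2 H L \<gamma> n T"
  defines "X \<equiv> iterate n H \<eta> C1 C2 f x0 Z"
  defines "F \<equiv> global_obj n D f"
  assumes \<delta>: "0 < \<delta>1" and H: "0 < H" and pos: "0 < \<gamma>" "0 < L"
    and C1: "approx_compressor \<delta>1 C1" "C1 \<in> borel_measurable borel"
    and C2: "approx_compressor \<delta>2 C2" "C2 \<in> borel_measurable borel"
    and n: "1 \<le> n" and nT: "(\<gamma> * L)\<^sup>2 * real n \<le> real T"
    and data: "distributed_data n D f"
    and smooth: "\<And>i. i \<in> {1..n} \<Longrightarrow> L_smooth L (local_obj D f i)"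
    and fresh: "fresh_samples M n T D Z"
    and bounds: "gradient_bounds M n T D f Z X V1 V1'"
    and min: "\<And>x. F xstar \<le> F x"
  shows "\<And>t. t \<in> {1..T} \<Longrightarrow> integrable M (\<lambda>\<omega>. (norm (nabla F (average n X (t - 1) \<omega>)))\<^sup>2)"
    and "1 / real T * (\<Sum>t=1..T. \<integral>\<omega>. (norm (nabla F (average n X (t - 1) \<omega>)))\<^sup>2 \<partial>M)
      \<le> cser_bound \<delta>1 \<delta>2 H L V1 (V1 + V1') \<gamma> (2 * (F x0 - F xstar)) n T"
proof -
  \<comment> \<open>The threshold on \<open>T\<close> already excludes an empty run, as its left
    side is positive.\<close>
  have T: "0 < T"
  proof -
    have "0 < (\<gamma> * L)\<^sup>2 * real n"
      using pos n by simp
    with nT show ?thesis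
      by linarith
  qed
  note eta = cser_stepsize_eq[OF pos n nT, of \<delta>1 \<delta>2 H, folded \<eta>_def]
  have den: "0 < sqrt (real T / real n) + cser_factor \<delta>1 \<delta>2 H * real T powr (1/3)"
    using n T by (intro add_pos_nonneg mult_nonneg_nonneg cser_factor_nonneg) auto
  have "\<eta> \<le> 1 / L"
    unfolding \<eta>_def cser_stepsize_def by simp
  then have "\<eta> * L \<le> 1"
    using pos by (simp add: field_simps)
  moreover have "0 \<le> \<eta>"
    unfolding eta using den pos by simp
  ultimately interpret cser_run M n T H L \<eta> \<delta>1 \<delta>2 V1 V1' C1 C2 D f Z x0
    using \<delta> H pos C1 C2 n data smooth fresh bounds[unfolded X_def]
    by (intro cser_run.intro cser_run_axioms.intro) (auto simp: fresh_samples_def)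
  show "integrable M (\<lambda>\<omega>. (norm (nabla F (average n X (t - 1) \<omega>)))\<^sup>2)" if "t \<in> {1..T}" for t
    using nabla_F_sq_integrable[of "t - 1"] that unfolding F_def X_def sq_integrable_def by auto
  let ?I = "\<lambda>t. \<integral>\<omega>. (norm (nabla F (average n X t \<omega>)))\<^sup>2 \<partial>M"
  \<comment> \<open>Needed for monotonicity in \<open>\<eta>\<close> when
    \<open>stepsize_bound\<close> enlarges the variance term.\<close>
  have V1: "0 \<le> V1"
  proof -
    have "0 \<le> expectation (\<lambda>\<omega>. (norm (dev 1 0 \<omega>))\<^sup>2)"
      by simp
    also have "\<dots> \<le> V1"
      using n T by (intro dev_sq_integrable) auto
    finally show ?thesis .
  qed
  have "\<eta> / 2 * (\<Sum>t<T. ?I t) \<le> F x0 - F xstar + real T * (\<eta> / 2 *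
      (L\<^sup>2 * (cser_factor \<delta>1 \<delta>2 H ^ 3 * \<eta>\<^sup>2 * (V1 + V1'))) + L * \<eta>\<^sup>2 / 2 * (V1 / real n))"
    using sum_gradient_bound[OF T min[unfolded F_def]] \<delta>_bounds
    by (simp add: cser_factor_cubed[OF \<delta>] F_def X_def mult.assoc mult.commute mult.left_commute)
  then have "1 / real T * (\<Sum>t<T. ?I t) \<le> cser_bound \<delta>1 \<delta>2 H L V1 (V1 + V1') \<gamma> (2 * (F x0 - F xstar)) n T"
    unfolding cser_bound_def using pos n T V1 second_moment_nonneg cser_factor_nonneg
    by (intro stepsize_bound[OF _ _ _ _ _ _ _ eta]) auto
  moreover have "(\<Sum>t=1..T. ?I (t - 1)) = (\<Sum>t<T. ?I t)"
    by (rule sum.reindex_bij_witness[of _ Suc "\<lambda>t. t - 1"]) auto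
  ultimately show "1 / real T * (\<Sum>t=1..T. ?I (t - 1))
      \<le> cser_bound \<delta>1 \<delta>2 H L V1 (V1 + V1') \<gamma> (2 * (F x0 - F xstar)) n T"
    by simp
qed

text \<open>The relation between \<open>T\<close> and \<open>n\<close> is read as
  \<open>c * n \<le> T\<close> with \<open>c\<close> chosen before workers, data and run. The order
  statement is read with \<open>K\<close> independent of \<open>n\<close>, while the number of
  iterations after which it holds may depend on \<open>n\<close>.\<close>

theorem corollary1:
  fixes \<delta>1 \<delta>2 L V1 V1' \<gamma> :: real
    and H :: nat
    and C1 C2 :: "'a::euclidean_space \<Rightarrow> 'a"
  assumes "0 < \<delta>1" "\<delta>1 \<le> 1" "0 \<le> \<delta>2" "\<delta>2 \<le> 1"
    and "approx_compressor \<delta>1 C1" "C1 \<in> borel_measurable borel"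
    and "approx_compressor \<delta>2 C2" "C2 \<in> borel_measurable borel"
    and "0 < H" "0 < \<gamma>" "0 < L"
  shows "(\<exists>c>0. \<forall>(n::nat) (T::nat) (D :: nat \<Rightarrow> 'z measure) (f :: 'a \<Rightarrow> 'z \<Rightarrow> real)
             (M :: 'w measure) (Z :: nat \<Rightarrow> nat \<Rightarrow> 'w \<Rightarrow> 'z) (x0 :: 'a) (xstar :: 'a).
           let \<eta> = cser_stepsize \<delta>1 \<delta>2 H L \<gamma> n T;
               X = iterate n H \<eta> C1 C2 f x0 Z;
               F = global_obj n D f;
               gap = (\<lambda>t \<omega>. (norm (nabla F (average n X (t - 1) \<omega>)))\<^sup>2)
           in 1 \<le> n \<and> c * real n \<le> real T
              \<and> distributed_data n D f
              \<and> (\<forall>i\<in>{1..n}. L_smooth L (local_obj D f i))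
              \<and> fresh_samples M n T D Z
              \<and> gradient_bounds M n T D f Z X V1 V1'
              \<and> (\<forall>x. F xstar \<le> F x)
              \<longrightarrow> (\<forall>t\<in>{1..T}. integrable M (gap t))
                \<and> 1 / real T * (\<Sum>t=1..T. integral\<^sup>L M (gap t))
                    \<le> cser_bound \<delta>1 \<delta>2 H L V1 (V1 + V1') \<gamma> (2 * (F x0 - F xstar)) n T)
       \<and> (\<forall>Fo. \<exists>K. \<forall>n\<ge>1. \<forall>\<^sub>F T in sequentially.
            cser_bound \<delta>1 \<delta>2 H L V1 (V1 + V1') \<gamma> Fo n T \<le> K / sqrt (real n * real T))"
  (is "?A \<and> ?B")
proof
  show ?A
  \<comment> \<open>From this threshold on, the minimum in the step size is attained by its first
    argument.\<close>
  proof (intro exI[of _ "(\<gamma> * L)\<^sup>2"] conjI allI)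
    show "0 < (\<gamma> * L)\<^sup>2"
      using assms by simp
  next
    fix n T :: nat and D :: "nat \<Rightarrow> 'z measure" and f :: "'a \<Rightarrow> 'z \<Rightarrow> real" and M :: "'w measure"
      and Z :: "nat \<Rightarrow> nat \<Rightarrow> 'w \<Rightarrow> 'z" and x0 xstar :: 'a
    note run = cser_run_bound[where n = n and T = T and D = D and f = f and M = M and Z = Z
        and ?x0.0 = x0 and xstar = xstar and V1' = V1',
        OF assms(1,9,10,11,5,6,7,8)]
    show "let \<eta> = cser_stepsize \<delta>1 \<delta>2 H L \<gamma> n T;
              X = iterate n H \<eta> C1 C2 f x0 Z;
              F = global_obj n D f;
              gap = (\<lambda>t \<omega>. (norm (nabla F (average n X (t - 1) \<omega>)))\<^sup>2)
          in 1 \<le> n \<and> (\<gamma> * L)\<^sup>2 * real n \<le> real T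
             \<and> distributed_data n D f
             \<and> (\<forall>i\<in>{1..n}. L_smooth L (local_obj D f i))
             \<and> fresh_samples M n T D Z
             \<and> gradient_bounds M n T D f Z X V1 V1'
             \<and> (\<forall>x. F xstar \<le> F x)
             \<longrightarrow> (\<forall>t\<in>{1..T}. integrable M (gap t))
               \<and> 1 / real T * (\<Sum>t=1..T. integral\<^sup>L M (gap t))
                   \<le> cser_bound \<delta>1 \<delta>2 H L V1 (V1 + V1') \<gamma> (2 * (F x0 - F xstar)) n T"
      unfolding Let_def by (intro impI conjI ballI; elim conjE) (rule run; blast)+
  qed
  show ?B
  proof
    fix Fo
    show "\<exists>K. \<forall>n\<ge>1. \<forall>\<^sub>F T in sequentially.
        cser_bound \<delta>1 \<delta>2 H L V1 (V1 + V1') \<gamma> Fo n T \<le> K / sqrt (real n * real T)"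
      \<comment> \<open>The added 1 is the strict margin above the leading coefficient; any positive
        number would do.\<close>
      by (intro exI[of _ "Fo / \<gamma> + \<gamma> * L * V1 + 1"] allI impI cser_bound_eventually_le) auto
  qed
qed

end
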